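(* Let $\theta$ be an inner function with $0$-th Fourier coefficient $\theta_0$, let $\phi\in L^\infty$, and let $A$ be a bounded linear operator on $K_\theta^\perp$ satisfying $$AU_\theta-U_\theta^*A=\bar z\otimes Q_\theta J(\alpha_{\phi^*})-Q_\theta J(\alpha_\phi)\otimes\bar z,$$ where $\alpha_\phi=\phi(1-\bar\theta_0\theta)$ and $\alpha_{\phi^*}=\phi^*(1-\bar\theta_0\theta)$. Then: (a) if $\theta_0\neq0$, then $A=\mathcal{H}_\phi^\theta$ if and only if $A\theta=\mathcal{H}_\phi^\theta(\theta)$; (b) if $\theta_0=0$, then $A=\mathcal{H}_\phi^\theta$ if and only if $A\theta=\mathcal{H}_\phi^\theta(\theta)$ and $A^*\theta=(\mathcal{H}_\phi^\theta)^*\theta$.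
   Context: $\mathbb{T}$ is the unit circle with normalized Lebesgue measure, $L^2=L^2(\mathbb{T})$ with inner product $\langle\cdot,\cdot\rangle$ linear in the first entry, $L^\infty=L^\infty(\mathbb{T})$. $H^2\subset L^2$ is the Hardy space (functions whose negative Fourier coefficients vanish), $H_0^2=zH^2$, $\overline{H_0^2}=L^2\ominus H^2$. $P:L^2\to H^2$ is the orthogonal projection and $Q=I-P$ is the orthogonal projection onto $\overline{H_0^2}$. The flip $J$ on $L^2$ is $(Jf)(z)=f(\bar z)$, $z\in\mathbb{T}$. For an inner function $\theta$ (bounded analytic on the disk, unimodular a.e. on $\mathbb{T}$), $K_\theta=H^2\ominus\theta H^2$ and $K_\theta^\perp=L^2\ominus K_\theta=\overline{H_0^2}\oplus\theta H^2$; $Q_\theta=Q+\theta P\bar\theta$ is the orthogonal projection of $L^2$ onto $K_\theta^\perp$. For $\phi\in L^\infty$ the dual truncated Hankel operator is $\mathcal{H}_\phi^\theta:K_\theta^\perp\to K_\theta^\perp$, $\mathcal{H}_\phi^\theta(h)=Q_\theta J(\phi h)$. The compressed shift on $K_\theta^\perp$ is $U_\theta h=Q_\theta(zh)$. For $f,g$ in a Hilbert space, $f\otimes g$ is the operator $h\mapsto\langle h,g\rangle f$. For $\phi\in L^2$, $\phi^*(z)=\overline{\phi(\bar z)}$ on $\mathbb{T}$. *)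

theory Defs
  imports "HOL-Complex_Analysis.Complex_Analysis"
begin

section \<open>Measurable functions on the unit circle modulo almost everywhere equality\<close>

text \<open>Normalized Lebesgue measure of the unit circle, as a Borel measure on the complex plane
  that is concentrated on the circle.\<close>

definition circ :: "complex measure" where
  "circ = distr (uniform_measure lborel {-pi..pi}) borel cis"

lemma sets_circ [simp, measurable_cong]: "sets circ = sets borel"
  by (simp add: circ_def)

lemma space_circ [simp]: "space circ = UNIV"
  by (simp add: circ_def)

lemma measurable_cis [measurable]: "cis \<in> borel_measurable borel"
  by (intro borel_measurable_continuous_onI continuous_intros)

lemma measurable_cnj [measurable]: "cnj \<in> borel_measurable borel"
  by (intro borel_measurable_continuous_onI continuous_intros)

lemma measurable_power_int [measurable]: "(\<lambda>z::complex. z powi n) \<in> borel_measurable borel"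
  by (cases "n \<ge> 0") (simp_all add: power_int_def)

lemma distr_uminus_uniform:
  "distr (uniform_measure lborel {-pi..pi}) borel uminus = uniform_measure lborel {-pi..pi}"
proof (rule measure_eqI)
  fix X :: "real set"
  assume "X \<in> sets (distr (uniform_measure lborel {-pi..pi}) borel uminus)"
  then have X [measurable]: "X \<in> sets borel" by simp
  have pre: "(uminus -` X) \<in> sets borel"
    using measurable_sets[of "uminus :: real \<Rightarrow> real" borel borel X] X by simp
  have "emeasure lborel ({-pi..pi} \<inter> X) = emeasure (distr lborel borel uminus) ({-pi..pi} \<inter> X)"
    using lborel_distr_uminus by simp
  also have "\<dots> = emeasure lborel (uminus -` ({-pi..pi} \<inter> X))"
    by (subst emeasure_distr) auto
  also have "uminus -` ({-pi..pi} \<inter> X) = {-pi..pi} \<inter> (uminus -` X)" by auto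
  finally have *: "emeasure lborel ({-pi..pi} \<inter> X) = emeasure lborel ({-pi..pi} \<inter> (uminus -` X))" .
  show "emeasure (distr (uniform_measure lborel {-pi..pi}) borel uminus) X =
      emeasure (uniform_measure lborel {-pi..pi}) X"
    using * pre by (simp add: emeasure_distr)
qed simp

lemma distr_cnj_circ: "distr circ borel cnj = circ"
proof -
  have "distr circ borel cnj = distr (uniform_measure lborel {-pi..pi}) borel (cnj \<circ> cis)"
    unfolding circ_def by (subst distr_distr) simp_all
  also have "cnj \<circ> cis = cis \<circ> uminus" by (simp add: fun_eq_iff cis_cnj)
  also have "distr (uniform_measure lborel {-pi..pi}) borel (cis \<circ> uminus) =
      distr (distr (uniform_measure lborel {-pi..pi}) borel uminus) borel cis"
    by (subst distr_distr) simp_all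
  finally show ?thesis by (simp add: distr_uminus_uniform circ_def)
qed

lemma AE_circ_cnj:
  fixes f g :: "complex \<Rightarrow> complex"
  assumes [measurable]: "f \<in> borel_measurable borel" "g \<in> borel_measurable borel"
    and "AE z in circ. f z = g z"
  shows "AE z in circ. f (cnj z) = g (cnj z)"
proof -
  have "AE z in distr circ borel cnj. f z = g z"
    unfolding distr_cnj_circ by (rule assms(3))
  then show ?thesis by (subst (asm) AE_distr_iff) simp_all
qed

text \<open>Each class has Borel representatives on the whole plane; their values off the circle are
  irrelevant because \<open>circ\<close> is concentrated on the circle.  Lebesgue measurable functions on the
  circle give no further classes.\<close>

quotient_type circ_fun = "complex \<Rightarrow> complex" / partial:
  "\<lambda>f g. f \<in> borel_measurable borel \<and> g \<in> borel_measurable borel \<and> (AE z in circ. f z = g z)"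
proof (rule part_equivpI)
  show "\<exists>f :: complex \<Rightarrow> complex. f \<in> borel_measurable borel \<and> f \<in> borel_measurable borel \<and> (AE z in circ. f z = f z)"
    by (rule exI[of _ "\<lambda>_::complex. 0::complex"]) simp
  show "symp (\<lambda>f g :: complex \<Rightarrow> complex. f \<in> borel_measurable borel \<and> g \<in> borel_measurable borel
      \<and> (AE z in circ. f z = g z))"
    by (auto simp: symp_def elim: AE_mp)
  show "transp (\<lambda>f g :: complex \<Rightarrow> complex. f \<in> borel_measurable borel \<and> g \<in> borel_measurable borel
      \<and> (AE z in circ. f z = g z))"
    by (auto simp: transp_def elim!: AE_mp)
qed

instantiation circ_fun :: comm_ring_1
begin

lift_definition zero_circ_fun :: circ_fun is "\<lambda>_. 0" by simp
lift_definition one_circ_fun :: circ_fun is "\<lambda>_. 1" by simp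
lift_definition plus_circ_fun :: "circ_fun \<Rightarrow> circ_fun \<Rightarrow> circ_fun" is "\<lambda>f g z. f z + g z"
  by (auto elim!: AE_mp)
lift_definition minus_circ_fun :: "circ_fun \<Rightarrow> circ_fun \<Rightarrow> circ_fun" is "\<lambda>f g z. f z - g z"
  by (auto elim!: AE_mp)
lift_definition uminus_circ_fun :: "circ_fun \<Rightarrow> circ_fun" is "\<lambda>f z. - f z"
  by (auto elim!: AE_mp)
lift_definition times_circ_fun :: "circ_fun \<Rightarrow> circ_fun \<Rightarrow> circ_fun" is "\<lambda>f g z. f z * g z"
  by (auto elim!: AE_mp)

instance
proof
  show "(0::circ_fun) \<noteq> 1"
  proof (transfer, safe)
    assume "AE z in circ. (0::complex) = 1"
    then have "AE x in uniform_measure lborel {-pi..pi}. False"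
      unfolding circ_def by (subst (asm) AE_distr_iff) simp_all
    then have "AE x in lborel. x \<in> {-pi..pi} \<longrightarrow> False"
      by (subst (asm) AE_uniform_measure) simp_all
    then have "{-pi..pi} \<in> null_sets lborel"
      by (subst AE_iff_null_sets) (auto elim: AE_mp)
    then show False by (simp add: null_sets_def)
  qed
qed (transfer; simp add: algebra_simps)+

end

lift_definition const_fun :: "complex \<Rightarrow> circ_fun" is "\<lambda>c _. c" by simp

lift_definition id_fun :: circ_fun is "\<lambda>z. z" by simp

lift_definition conj_fun :: "circ_fun \<Rightarrow> circ_fun" is "\<lambda>f z. cnj (f z)"
  by (auto elim!: AE_mp)

lift_definition flip :: "circ_fun \<Rightarrow> circ_fun" is "\<lambda>f z. f (cnj z)"
  using AE_circ_cnj by auto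

definition star :: "circ_fun \<Rightarrow> circ_fun" where
  "star \<phi> = conj_fun (flip \<phi>)"

section \<open>Lebesgue spaces and Hardy space\<close>

lift_definition square_integrable :: "circ_fun \<Rightarrow> bool" is
  "\<lambda>f. integrable circ (\<lambda>z. (norm (f z))\<^sup>2)"
  by (intro integrable_cong_AE) (auto elim!: AE_mp)

lift_definition ess_bounded :: "circ_fun \<Rightarrow> bool" is
  "\<lambda>f. \<exists>C. AE z in circ. norm (f z) \<le> C"
proof -
  fix f g :: "complex \<Rightarrow> complex"
  assume *: "f \<in> borel_measurable borel \<and> g \<in> borel_measurable borel \<and> (AE z in circ. f z = g z)"
  have "(AE z in circ. norm (f z) \<le> C) \<longleftrightarrow> (AE z in circ. norm (g z) \<le> C)" for C
    using * by (auto elim!: AE_mp)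
  then show "(\<exists>C. AE z in circ. norm (f z) \<le> C) = (\<exists>C. AE z in circ. norm (g z) \<le> C)" by simp
qed

lift_definition unimodular :: "circ_fun \<Rightarrow> bool" is "\<lambda>f. AE z in circ. norm (f z) = 1"
  by (auto elim!: AE_mp)

lift_definition l2_inner :: "circ_fun \<Rightarrow> circ_fun \<Rightarrow> complex" is
  "\<lambda>f g. \<integral>z. f z * cnj (g z) \<partial>circ"
  by (intro integral_cong_AE) (auto elim!: AE_mp)

lift_definition fourier_coeff :: "circ_fun \<Rightarrow> int \<Rightarrow> complex" is
  "\<lambda>f n. \<integral>z. f z * cnj (z powi n) \<partial>circ"
  by (intro ext integral_cong_AE) (auto elim!: AE_mp)

definition L2 :: "circ_fun set" where "L2 = {f. square_integrable f}"

definition Linf :: "circ_fun set" where "Linf = {f. ess_bounded f}"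

definition H2 :: "circ_fun set" where
  "H2 = {f \<in> L2. \<forall>n<0. fourier_coeff f n = 0}"

definition l2_norm :: "circ_fun \<Rightarrow> real" where
  "l2_norm f = sqrt (Re (l2_inner f f))"

definition ominus :: "circ_fun set \<Rightarrow> circ_fun set \<Rightarrow> circ_fun set"  (infixl "\<ominus>" 65) where
  "M \<ominus> N = {f \<in> M. \<forall>g\<in>N. l2_inner f g = 0}"

text \<open>The point described by \<open>orth_proj M f\<close> is unique when \<open>M\<close> is a linear subspace of \<open>L2\<close>, and
  exists when moreover \<open>M\<close> is closed and \<open>f \<in> L2\<close>.  The same applies to \<open>adjoint_on\<close> below, for
  bounded operators.\<close>

definition orth_proj :: "circ_fun set \<Rightarrow> circ_fun \<Rightarrow> circ_fun" where
  "orth_proj M f = (THE p. p \<in> M \<and> (\<forall>g\<in>M. l2_inner (f - p) g = 0))"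

section \<open>Operators\<close>

text \<open>An operator on a closed subspace \<open>M\<close> of \<open>L2\<close> is a function on \<open>circ_fun\<close> of which only the
  values on \<open>M\<close> are relevant; accordingly equality of operators means equality at every
  element of \<open>M\<close>.\<close>

definition bounded_operator_on :: "circ_fun set \<Rightarrow> (circ_fun \<Rightarrow> circ_fun) \<Rightarrow> bool" where
  "bounded_operator_on M T \<longleftrightarrow>
     (\<forall>f\<in>M. T f \<in> M) \<and>
     (\<forall>f\<in>M. \<forall>g\<in>M. T (f + g) = T f + T g) \<and>
     (\<forall>c. \<forall>f\<in>M. T (const_fun c * f) = const_fun c * T f) \<and>
     (\<exists>C. \<forall>f\<in>M. l2_norm (T f) \<le> C * l2_norm f)"

definition op_eq_on :: "circ_fun set \<Rightarrow> (circ_fun \<Rightarrow> circ_fun) \<Rightarrow> (circ_fun \<Rightarrow> circ_fun) \<Rightarrow> bool" where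
  "op_eq_on M S T \<longleftrightarrow> (\<forall>f\<in>M. S f = T f)"

definition adjoint_on ::
    "circ_fun set \<Rightarrow> (circ_fun \<Rightarrow> circ_fun) \<Rightarrow> circ_fun \<Rightarrow> circ_fun" where
  "adjoint_on M T g = (THE k. k \<in> M \<and> (\<forall>f\<in>M. l2_inner (T f) g = l2_inner f k))"

definition rank_one :: "circ_fun \<Rightarrow> circ_fun \<Rightarrow> circ_fun \<Rightarrow> circ_fun" where
  "rank_one f g h = const_fun (l2_inner h g) * f"

definition proj_H2 :: "circ_fun \<Rightarrow> circ_fun" where "proj_H2 = orth_proj H2"

definition coproj_H2 :: "circ_fun \<Rightarrow> circ_fun" where "coproj_H2 f = f - proj_H2 f"

section \<open>Inner functions and dual truncated Hankel operators\<close>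

text \<open>An inner function is identified with its boundary function on the circle.\<close>

lift_definition has_radial_limits :: "(complex \<Rightarrow> complex) \<Rightarrow> circ_fun \<Rightarrow> bool" is
  "\<lambda>F f. AE z in circ. ((\<lambda>r. F (of_real r * z)) \<longlongrightarrow> f z) (at_left 1)"
  by (auto elim!: AE_mp)

definition inner_fun :: "circ_fun \<Rightarrow> bool" where
  "inner_fun \<theta> \<longleftrightarrow>
     (\<exists>F. F holomorphic_on ball 0 1 \<and> bounded (F ` ball 0 1) \<and> has_radial_limits F \<theta>) \<and>
     unimodular \<theta>"

definition model_space :: "circ_fun \<Rightarrow> circ_fun set" where
  "model_space \<theta> = H2 \<ominus> (\<lambda>f. \<theta> * f) ` H2"

definition model_perp :: "circ_fun \<Rightarrow> circ_fun set" where
  "model_perp \<theta> = L2 \<ominus> model_space \<theta>"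

definition Q_theta :: "circ_fun \<Rightarrow> circ_fun \<Rightarrow> circ_fun" where
  "Q_theta \<theta> f = coproj_H2 f + \<theta> * proj_H2 (conj_fun \<theta> * f)"

definition dual_hankel :: "circ_fun \<Rightarrow> circ_fun \<Rightarrow> circ_fun \<Rightarrow> circ_fun" where
  "dual_hankel \<theta> \<phi> h = Q_theta \<theta> (flip (\<phi> * h))"

definition compressed_shift :: "circ_fun \<Rightarrow> circ_fun \<Rightarrow> circ_fun" where
  "compressed_shift \<theta> h = Q_theta \<theta> (id_fun * h)"

definition alpha :: "circ_fun \<Rightarrow> circ_fun \<Rightarrow> circ_fun" where
  "alpha \<theta> \<phi> = \<phi> * (1 - const_fun (cnj (fourier_coeff \<theta> 0)) * \<theta>)"

end

theory Submission
  imports Defs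
begin

text \<open>Write \<open>K\<close> for the model space, \<open>M\<close> for its orthogonal complement, \<open>T\<close> for the operator \<open>Q_theta\<close>, and
  \<open>\<theta>0\<close> for the constant coefficient of \<open>\<theta>\<close>.  The space \<open>M\<close> is the orthogonal sum of the functions with
  negative frequencies and of \<open>\<theta> H2\<close>, and \<open>T\<close> is the orthogonal projection onto it.

  The dual truncated Hankel operator \<open>H\<close> with symbol \<open>\<phi>\<close> satisfies the operator equation imposed on \<open>A\<close>
  (lemma \<open>dual_hankel_shift\<close>): without compressions the flip would intertwine multiplication by \<open>z\<close> with
  multiplication by its conjugate, and each of the two compressions adds one rank one term.  Hence \<open>D = A - H\<close>
  satisfies the homogeneous equation \<open>D U = U\<^sup>* D\<close>, where \<open>U\<close> is the compressed shift.

  In the orthonormal basis of \<open>M\<close> formed by the powers \<open>z\<^sup>-\<^sup>n\<close> with \<open>n \<ge> 1\<close> and the vectors \<open>\<theta> z\<^sup>n\<close> with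
  \<open>n \<ge> 0\<close>, the operator \<open>U\<close> is a weighted bilateral shift all of whose weights are one, except that it maps
  \<open>z\<^sup>-\<^sup>1\<close> to \<open>cnj \<theta>0\<close> times \<open>\<theta>\<close>.  If \<open>D \<theta> = 0\<close>, the equation gives \<open>D = 0\<close> on the forward orbit of \<open>\<theta>\<close>.
  Going backwards, \<open>U\<^sup>* D\<close> vanishes successively on the powers \<open>z\<^sup>-\<^sup>n\<close>.  If \<open>\<theta>0 \<noteq> 0\<close>, then \<open>U\<^sup>*\<close> is
  injective and \<open>D\<close> vanishes there too.  If \<open>\<theta>0 = 0\<close>, the kernel of \<open>U\<^sup>*\<close> is spanned by \<open>\<theta>\<close>, and the second
  condition says that the range of \<open>D\<close> is orthogonal to \<open>\<theta>\<close>.  This is \<open>kernel_backward_shift\<close> and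
  \<open>intertwiner_eq_0\<close>.

  The analytic foundation consists of the Riesz-Fischer theorem, which yields the projection onto \<open>H2\<close> and
  the adjoints, of the uniqueness of Fourier coefficients, which yields norm convergence of Fourier series and
  thereby density of the basis, and of the vanishing of the negative coefficients of an inner function.\<close>

section \<open>Integration on the circle\<close>

lemma emeasure_pi: "emeasure lborel {-pi..pi} = ennreal (2 * pi)"
  by simp

lemma emeasure_circ: "emeasure circ UNIV = 1"
  unfolding circ_def by (simp add: emeasure_distr divide_ennreal)

interpretation circ: finite_measure circ
  by (rule finite_measureI) (simp add: emeasure_circ)

lemma measure_circ: "measure circ UNIV = 1"
  by (simp add: measure_def emeasure_circ)

lemma AE_circ_norm: "AE z in circ. norm z = 1"
  unfolding circ_def by (subst AE_distr_iff) simp_all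

lemma integral_circ:
  fixes g :: "complex \<Rightarrow> complex"
  assumes [measurable]: "g \<in> borel_measurable borel"
  shows "(\<integral>z. g z \<partial>circ) = (\<integral>t. indicator {-pi..pi} t *\<^sub>R g (cis t) \<partial>lborel) / (2 * pi)"
proof -
  have u: "uniform_measure lborel {-pi..pi} =
      density lborel (\<lambda>t. ennreal (indicator {-pi..pi} t / (2 * pi)))"
    unfolding uniform_measure_def emeasure_pi
    by (intro density_cong) (auto simp: divide_ennreal indicator_def simp flip: ennreal_1 )
  have "(\<integral>z. g z \<partial>circ) = (\<integral>t. (indicator {-pi..pi} t / (2 * pi)) *\<^sub>R g (cis t) \<partial>lborel)"
    unfolding circ_def u by (subst integral_distr, simp, simp, subst integral_density) simp_all
  also have "\<dots> = (\<integral>t. (indicator {-pi..pi} t *\<^sub>R g (cis t)) / (2 * pi) \<partial>lborel)"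
    by (intro Bochner_Integration.integral_cong) (auto simp: indicator_def scaleR_conv_of_real)
  finally show ?thesis by simp
qed

lemma integral_circ_power_int: "(\<integral>z. z powi n \<partial>circ) = (if n = 0 then 1 else 0)"
proof (cases "n = 0")
  case False
  have c: "cis t powi n = exp (\<i> * (of_int n * complex_of_real t))" for t
    by (simp add: cis_conv_exp exp_power_int mult_ac)
  have "(\<integral>t. indicator {-pi..pi} t *\<^sub>R (cis t powi n) \<partial>lborel) =
      exp (\<i> * (of_int n * complex_of_real pi)) / (\<i> * of_int n)
    - exp (\<i> * (of_int n * complex_of_real (-pi))) / (\<i> * of_int n)"
    unfolding c
  proof (rule integral_FTC_atLeastAtMost)
    fix t :: real
    have "((\<lambda>w. exp (\<i> * (of_int n * w))) has_field_derivative
        exp (\<i> * (of_int n * complex_of_real t)) * (\<i> * of_int n)) (at (complex_of_real t))"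
      by (auto intro!: derivative_eq_intros)
    from DERIV_cdivide[OF this, of "\<i> * of_int n"]
    have "((\<lambda>w. exp (\<i> * (of_int n * w)) / (\<i> * of_int n)) has_field_derivative
        exp (\<i> * (of_int n * complex_of_real t))) (at (complex_of_real t))"
      using False by simp
    then show "((\<lambda>x. exp (\<i> * (of_int n * complex_of_real x)) / (\<i> * of_int n))
        has_vector_derivative exp (\<i> * (of_int n * complex_of_real t))) (at t within {-pi..pi})"
      by (rule has_vector_derivative_real_field)
  qed (auto intro!: continuous_intros)
  also have "exp (\<i> * (of_int n * complex_of_real (-pi))) = exp (\<i> * (of_int n * complex_of_real pi))"
    by (subst exp_eq, rule exI[of _ "- n"]) (simp add: algebra_simps)
  finally show ?thesis using False by (subst integral_circ) simp_all
qed (simp add: measure_circ)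

section \<open>Pointwise operations and the space of square integrable functions\<close>

lemma const_fun_simps:
  "const_fun (a + b) = const_fun a + const_fun b"
  "const_fun (a - b) = const_fun a - const_fun b"
  "const_fun (a * b) = const_fun a * const_fun b"
  "const_fun (- a) = - const_fun a"
  "const_fun 0 = 0" "const_fun 1 = 1"
  by (transfer; simp)+

lemma conj_fun_simps:
  "conj_fun (f + g) = conj_fun f + conj_fun g"
  "conj_fun (f - g) = conj_fun f - conj_fun g"
  "conj_fun (f * g) = conj_fun f * conj_fun g"
  "conj_fun (conj_fun f) = f"
  "conj_fun (const_fun c) = const_fun (cnj c)"
  "conj_fun 1 = 1"
  by (transfer; simp)+

lemma flip_simps:
  "flip (f + g) = flip f + flip g"
  "flip (f - g) = flip f - flip g"
  "flip (f * g) = flip f * flip g"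
  "flip (const_fun c) = const_fun c"
  "flip (flip f) = f"
  "flip (conj_fun f) = conj_fun (flip f)"
  "flip 1 = 1"
  by (transfer; simp add: AE_circ_cnj)+

text \<open>The characters of the circle: an orthonormal family, whose coefficients are the Fourier coefficients.
  Indexing by integers makes \<open>zpow 1\<close> multiplication by \<open>z\<close> and \<open>zpow (-1)\<close> its adjoint.\<close>

lift_definition zpow :: "int \<Rightarrow> circ_fun" is "\<lambda>n z. z powi n" by simp

lemma zpow_0: "zpow 0 = 1" by transfer simp
lemma zpow_1: "zpow 1 = id_fun" by transfer simp
lemma zpow_add: "zpow (m + n) = zpow m * zpow n"
proof (transfer, intro conjI)
  fix m n :: int
  show "AE z in circ. z powi (m + n) = z powi m * z powi n"
    using AE_circ_norm
  proof eventually_elim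
    case (elim z)
    then have "z \<noteq> 0" by auto
    then show ?case by (simp add: power_int_add)
  qed
qed simp_all

lemma cnj_powi: "norm z = 1 \<Longrightarrow> cnj z powi n = z powi (- n)"
proof -
  assume z: "norm z = 1"
  have "cnj z = inverse z" using z by (simp add: inverse_eq_divide divide_conv_cnj)
  then show ?thesis by (simp add: power_int_minus power_int_inverse)
qed

lemma conj_zpow: "conj_fun (zpow n) = zpow (- n)"
  using AE_circ_norm by transfer (auto elim!: AE_mp simp: cnj_powi)

lemma flip_zpow: "flip (zpow n) = zpow (- n)"
proof -
  have "flip (zpow n) = conj_fun (zpow n)" by transfer simp
  then show ?thesis by (simp add: conj_zpow)
qed

lemma fourier_coeff_conv_inner: "fourier_coeff f n = l2_inner f (zpow n)"
  by transfer simp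

text \<open>Multiplication by \<open>a\<close> has multiplication by the conjugate of \<open>a\<close> as its formal adjoint.  The integrands
  agree pointwise, whence no integrability is involved.\<close>

lemma l2_inner_mult: "l2_inner (a * f) g = l2_inner f (conj_fun a * g)"
  by transfer (simp add: mult_ac)
lemma l2_inner_const_left: "l2_inner (const_fun c * f) g = c * l2_inner f g"
  by transfer (simp add: mult_ac)
lemma l2_inner_cnj: "l2_inner g f = cnj (l2_inner f g)"
  apply transfer
  apply (subst Bochner_Integration.integral_cnj[symmetric])
  apply (rule Bochner_Integration.integral_cong)
  by auto
lemma l2_inner_const_right: "l2_inner f (const_fun c * g) = cnj c * l2_inner f g"
  using l2_inner_const_left[of c g f] l2_inner_cnj[of f g] l2_inner_cnj[of f "const_fun c * g"] by simp

lemma integral_circ_cnj: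
  fixes g :: "complex \<Rightarrow> complex"
  assumes [measurable]: "g \<in> borel_measurable borel"
  shows "(\<integral>z. g (cnj z) \<partial>circ) = (\<integral>z. g z \<partial>circ)"
  using integral_distr[of cnj circ borel g] by (simp add: distr_cnj_circ)

text \<open>The measure is invariant under conjugation, which makes the flip self-adjoint.\<close>

lemma l2_inner_flip: "l2_inner (flip f) g = l2_inner f (flip g)"
proof transfer
  fix f g :: "complex \<Rightarrow> complex"
  assume meas: "f \<in> borel_measurable borel \<and> f \<in> borel_measurable borel \<and> (AE z in circ. f z = f z)"
   "g \<in> borel_measurable borel \<and> g \<in> borel_measurable borel \<and> (AE z in circ. g z = g z)"
  from meas have [measurable]: "f \<in> borel_measurable borel" "g \<in> borel_measurable borel" by simp_all
  have "(\<integral>z. f (cnj z) * cnj (g (cnj (cnj z))) \<partial>circ) = (\<integral>z. f z * cnj (g (cnj z)) \<partial>circ)"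
    by (rule integral_circ_cnj[of "\<lambda>z. f z * cnj (g (cnj z))"]) measurable
  then show "(\<integral>z. f (cnj z) * cnj (g z) \<partial>circ) = (\<integral>z. f z * cnj (g (cnj z)) \<partial>circ)" by simp
qed

lemma l2_inner_zpow: "l2_inner (zpow m) (zpow n) = (if m = n then 1 else 0)"
proof -
  have "l2_inner (zpow m) (zpow n) = l2_inner (zpow (m - n)) 1"
    using l2_inner_mult[of "zpow n" "zpow (m - n)" "zpow n"]
    by (simp flip: zpow_add add: conj_zpow zpow_0)
  also have "\<dots> = (if m = n then 1 else 0)"
    by transfer (simp add: integral_circ_power_int)
  finally show ?thesis .
qed

text \<open>Sums and products of square integrable functions are dominated by the sum of the squares; this is the
  common reason for all integrability claims about them.\<close>

lemma integrable_sq_bound: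
  fixes f g :: "complex \<Rightarrow> complex" and h :: "complex \<Rightarrow> 'a :: {banach, second_countable_topology}"
  assumes [measurable]: "h \<in> borel_measurable borel"
  assumes "integrable circ (\<lambda>z. (norm (f z))\<^sup>2)" "integrable circ (\<lambda>z. (norm (g z))\<^sup>2)"
    and "AE z in circ. norm (h z) \<le> C * ((norm (f z))\<^sup>2 + (norm (g z))\<^sup>2)"
  shows "integrable circ h"
  by (rule Bochner_Integration.integrable_bound[of _ "\<lambda>z. C * ((norm (f z))\<^sup>2 + (norm (g z))\<^sup>2)"])
     (use assms in \<open>auto elim!: AE_mp\<close>)

lemma sq_sum_le: "(norm (a + b :: complex))\<^sup>2 \<le> 2 * ((norm a)\<^sup>2 + (norm b)\<^sup>2)"
proof -
  have "(norm (a + b))\<^sup>2 \<le> (norm a + norm b)\<^sup>2" by (intro power_mono norm_triangle_ineq) simp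
  also have "\<dots> \<le> 2 * ((norm a)\<^sup>2 + (norm b)\<^sup>2)"
    using zero_le_power2[of "norm a - norm b"] by (simp add: power2_eq_square algebra_simps)
  finally show ?thesis .
qed

lemma L2_add: "f \<in> L2 \<Longrightarrow> g \<in> L2 \<Longrightarrow> f + g \<in> L2"
  unfolding L2_def mem_Collect_eq
proof transfer
  fix f g :: "complex \<Rightarrow> complex"
  assume meas: "f \<in> borel_measurable borel \<and> f \<in> borel_measurable borel \<and> (AE z in circ. f z = f z)"
   "g \<in> borel_measurable borel \<and> g \<in> borel_measurable borel \<and> (AE z in circ. g z = g z)"
  from meas have [measurable]: "f \<in> borel_measurable borel" "g \<in> borel_measurable borel" by simp_all
  assume i: "integrable circ (\<lambda>z. (norm (f z))\<^sup>2)" "integrable circ (\<lambda>z. (norm (g z))\<^sup>2)"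
  show "integrable circ (\<lambda>z. (norm (f z + g z))\<^sup>2)"
    by (rule integrable_sq_bound[OF _ i, of _ 2]) (simp_all add: sq_sum_le[simplified] del: of_real_power)
qed

lemma L2_mult_Linf: "a \<in> Linf \<Longrightarrow> f \<in> L2 \<Longrightarrow> a * f \<in> L2"
  unfolding L2_def Linf_def mem_Collect_eq
proof transfer
  fix a f :: "complex \<Rightarrow> complex"
  assume meas: "f \<in> borel_measurable borel \<and> f \<in> borel_measurable borel \<and> (AE z in circ. f z = f z)"
   "a \<in> borel_measurable borel \<and> a \<in> borel_measurable borel \<and> (AE z in circ. a z = a z)"
  from meas have [measurable]: "f \<in> borel_measurable borel" "a \<in> borel_measurable borel" by simp_all
  assume i: "integrable circ (\<lambda>z. (norm (f z))\<^sup>2)" and "\<exists>C. AE z in circ. norm (a z) \<le> C"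
  then obtain C where "AE z in circ. norm (a z) \<le> C" by blast
  then have "AE z in circ. norm ((norm (a z * f z))\<^sup>2) \<le> norm (C\<^sup>2 * (norm (f z))\<^sup>2)"
    by eventually_elim (auto simp: norm_mult power_mult_distrib intro!: mult_right_mono power_mono)
  then show "integrable circ (\<lambda>z. (norm (a z * f z))\<^sup>2)"
    by (intro Bochner_Integration.integrable_bound[OF integrable_mult_right[OF i, of "C\<^sup>2"]]) auto
qed

lemma Linf_const: "const_fun c \<in> Linf"
  unfolding Linf_def mem_Collect_eq by transfer auto

lemma Linf_zpow: "zpow n \<in> Linf"
  unfolding Linf_def mem_Collect_eq
proof transfer
  fix n
  have "AE z in circ. norm (z powi n) \<le> 1"
    using AE_circ_norm by eventually_elim (simp add: norm_power_int)
  then show "\<exists>C. AE z in circ. norm (z powi n) \<le> C" by blast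
qed

lemma Linf_conj: "a \<in> Linf \<Longrightarrow> conj_fun a \<in> Linf"
  unfolding Linf_def mem_Collect_eq by transfer simp

lemma unimodular_Linf: "unimodular a \<Longrightarrow> a \<in> Linf"
  unfolding Linf_def mem_Collect_eq
proof transfer
  fix a :: "complex \<Rightarrow> complex"
  assume "AE z in circ. norm (a z) = 1"
  then have "AE z in circ. norm (a z) \<le> 1" by (auto elim: AE_mp)
  then show "\<exists>C. AE z in circ. norm (a z) \<le> C" by blast
qed

lemma unimodular_conj: "unimodular a \<Longrightarrow> conj_fun a * a = 1"
proof transfer
  fix a :: "complex \<Rightarrow> complex"
  assume meas: "a \<in> borel_measurable borel \<and> a \<in> borel_measurable borel \<and> (AE z in circ. a z = a z)"
  from meas have [measurable]: "a \<in> borel_measurable borel" by simp_all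
  assume "AE z in circ. norm (a z) = 1"
  then have "AE z in circ. cnj (a z) * a z = 1"
  proof eventually_elim
    case (elim z)
    have "cnj (a z) * a z = of_real ((norm (a z))\<^sup>2)"
     using complex_norm_square[of "a z"] by (simp add: mult.commute)
    with elim show ?case by simp
  qed
  then show "(\<lambda>z. cnj (a z) * a z) \<in> borel_measurable borel \<and> (\<lambda>_. 1::complex) \<in> borel_measurable borel \<and>
    (AE z in circ. cnj (a z) * a z = 1)" by simp
qed

lemma L2_one: "1 \<in> L2"
  unfolding L2_def mem_Collect_eq by transfer simp

lemma Linf_L2: "a \<in> Linf \<Longrightarrow> a \<in> L2"
  using L2_mult_Linf[of a 1] L2_one by simp

lemma L2_const: "f \<in> L2 \<Longrightarrow> const_fun c * f \<in> L2" by (simp add: L2_mult_Linf Linf_const)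
lemma L2_zpow: "f \<in> L2 \<Longrightarrow> zpow n * f \<in> L2" by (simp add: L2_mult_Linf Linf_zpow)
lemma zpow_L2: "zpow n \<in> L2" by (simp add: Linf_L2 Linf_zpow)
lemma L2_0: "0 \<in> L2" using L2_const[OF L2_one, of 0] by (simp add: const_fun_simps)
lemma L2_uminus: "f \<in> L2 \<Longrightarrow> - f \<in> L2"
  using L2_const[of f "-1"] by (simp add: const_fun_simps)
lemma L2_diff: "f \<in> L2 \<Longrightarrow> g \<in> L2 \<Longrightarrow> f - g \<in> L2"
  using L2_add[of f "-g"] L2_uminus[of g] by simp
lemma L2_sum: "(\<And>i. i \<in> I \<Longrightarrow> f i \<in> L2) \<Longrightarrow> sum f I \<in> L2"
  by (induction I rule: infinite_finite_induct) (auto intro: L2_0 L2_add)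

lemma L2_flip: "f \<in> L2 \<Longrightarrow> flip f \<in> L2"
  unfolding L2_def mem_Collect_eq
proof transfer
  fix f :: "complex \<Rightarrow> complex"
  assume meas: "f \<in> borel_measurable borel \<and> f \<in> borel_measurable borel \<and> (AE z in circ. f z = f z)"
  from meas have [measurable]: "f \<in> borel_measurable borel" by simp_all
  assume "integrable circ (\<lambda>z. (norm (f z))\<^sup>2)"
  then have "integrable (distr circ borel cnj) (\<lambda>z. (norm (f z))\<^sup>2)" by (simp add: distr_cnj_circ)
  then show "integrable circ (\<lambda>z. (norm (f (cnj z)))\<^sup>2)"
    by (subst (asm) integrable_distr_eq) simp_all
qed

lemma integrable_inner:
  fixes f g :: "complex \<Rightarrow> complex"
  assumes [measurable]: "f \<in> borel_measurable borel" "g \<in> borel_measurable borel"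
  assumes i: "integrable circ (\<lambda>z. (norm (f z))\<^sup>2)" "integrable circ (\<lambda>z. (norm (g z))\<^sup>2)"
  shows "integrable circ (\<lambda>z. f z * cnj (g z))"
proof (rule integrable_sq_bound[OF _ i, of _ 1])
  have bound: "x * y \<le> 1 * (x\<^sup>2 + y\<^sup>2)" if "0 \<le> x" "0 \<le> y" for x y :: real
    using zero_le_power2[of "x - y"] mult_nonneg_nonneg[OF that] by (simp add: power2_diff)
  have "norm (f z * cnj (g z)) \<le> 1 * ((norm (f z))\<^sup>2 + (norm (g z))\<^sup>2)" for z
    unfolding norm_mult complex_mod_cnj by (rule bound) simp_all
  then show "AE z in circ. norm (f z * cnj (g z)) \<le> 1 * ((norm (f z))\<^sup>2 + (norm (g z))\<^sup>2)" by simp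
qed measurable

lemma l2_inner_add_left: "f \<in> L2 \<Longrightarrow> g \<in> L2 \<Longrightarrow> h \<in> L2 \<Longrightarrow> l2_inner (f + g) h = l2_inner f h + l2_inner g h"
  unfolding L2_def mem_Collect_eq
  by transfer (simp add: ring_distribs integrable_inner)

lemma l2_inner_self_eq_0: "f \<in> L2 \<Longrightarrow> l2_inner f f = 0 \<Longrightarrow> f = 0"
  unfolding L2_def mem_Collect_eq
proof transfer
  fix f :: "complex \<Rightarrow> complex"
  assume meas: "f \<in> borel_measurable borel \<and> f \<in> borel_measurable borel \<and> (AE z in circ. f z = f z)"
  from meas have [measurable]: "f \<in> borel_measurable borel" by simp_all
  assume i: "integrable circ (\<lambda>z. (norm (f z))\<^sup>2)"
  assume "(\<integral>z. f z * cnj (f z) \<partial>circ) = 0"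
  then have "(\<integral>z. complex_of_real ((norm (f z))\<^sup>2) \<partial>circ) = 0"
    by (simp add: complex_norm_square del: of_real_power)
  then have "(\<integral>z. ((norm (f z))\<^sup>2) \<partial>circ) = 0"
    by (simp add: integral_complex_of_real del: of_real_power)
  then have "AE z in circ. (norm (f z))\<^sup>2 = 0"
    by (subst (asm) integral_nonneg_eq_0_iff_AE[OF i]) auto
  then show "f \<in> borel_measurable borel \<and> (\<lambda>_. 0::complex) \<in> borel_measurable borel \<and> (AE z in circ. f z = 0)"
    by (auto elim: AE_mp)
qed

lemma l2_inner_self: "l2_inner f f = of_real (Re (l2_inner f f))" "Re (l2_inner f f) \<ge> 0"
proof -
  have "\<exists>r\<ge>0. l2_inner f f = of_real r"
  proof transfer
    fix f :: "complex \<Rightarrow> complex"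
    have "(\<integral>z. f z * cnj (f z) \<partial>circ) = of_real (\<integral>z. (norm (f z))\<^sup>2 \<partial>circ)"
      by (simp add: complex_norm_square del: of_real_power flip: integral_complex_of_real)
    then show "\<exists>r\<ge>0. (\<integral>z. f z * cnj (f z) \<partial>circ) = of_real r"
      by (intro exI[of _ "\<integral>z. (norm (f z))\<^sup>2 \<partial>circ"]) simp
  qed
  then show "l2_inner f f = of_real (Re (l2_inner f f))" "Re (l2_inner f f) \<ge> 0" by auto
qed

lemma l2_inner_add_right: "f \<in> L2 \<Longrightarrow> g \<in> L2 \<Longrightarrow> h \<in> L2 \<Longrightarrow> l2_inner h (f + g) = l2_inner h f + l2_inner h g"
  using l2_inner_add_left[of f g h] by (metis complex_cnj_add l2_inner_cnj)

lemma l2_inner_zero: "l2_inner 0 f = 0" "l2_inner f 0 = 0"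
  using l2_inner_const_left[of 0 0 f] l2_inner_const_right[of f 0 0] by (simp_all add: const_fun_simps)

lemma l2_inner_uminus: "l2_inner (- f) g = - l2_inner f g" "l2_inner g (- f) = - l2_inner g f"
  using l2_inner_const_left[of "-1" f g] l2_inner_const_right[of g "-1" f]
  by (simp_all add: const_fun_simps)

lemma l2_inner_diff_left: "f \<in> L2 \<Longrightarrow> g \<in> L2 \<Longrightarrow> h \<in> L2 \<Longrightarrow> l2_inner (f - g) h = l2_inner f h - l2_inner g h"
  using l2_inner_add_left[of f "- g" h] by (simp add: l2_inner_uminus L2_uminus)

lemma l2_inner_diff_right: "f \<in> L2 \<Longrightarrow> g \<in> L2 \<Longrightarrow> h \<in> L2 \<Longrightarrow> l2_inner h (f - g) = l2_inner h f - l2_inner h g"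
  using l2_inner_add_right[of f "- g" h] by (simp add: l2_inner_uminus L2_uminus)

lemma l2_inner_sum_left: "(\<And>i. i \<in> I \<Longrightarrow> f i \<in> L2) \<Longrightarrow> g \<in> L2 \<Longrightarrow> l2_inner (sum f I) g = (\<Sum>i\<in>I. l2_inner (f i) g)"
  by (induction I rule: infinite_finite_induct) (auto simp: l2_inner_zero l2_inner_add_left L2_sum)

lemma l2_inner_self_norm: "l2_inner f f = of_real ((l2_norm f)\<^sup>2)"
  using l2_inner_self[of f] unfolding l2_norm_def by simp

lemma l2_norm_ge_0: "l2_norm f \<ge> 0"
  unfolding l2_norm_def using l2_inner_self by simp

lemma l2_norm_eq_0: "f \<in> L2 \<Longrightarrow> l2_norm f = 0 \<Longrightarrow> f = 0"
  using l2_inner_self_eq_0[of f] l2_inner_self_norm[of f] by simp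

lemma l2_norm_sq: "(l2_norm f)\<^sup>2 = Re (l2_inner f f)"
  by (simp add: l2_inner_self_norm del: of_real_power)

lemma l2_norm_const: "l2_norm (const_fun c * f) = norm c * l2_norm f"
proof -
  have "l2_inner (const_fun c * f) (const_fun c * f) = of_real ((norm c)\<^sup>2) * l2_inner f f"
    unfolding complex_norm_square by (simp add: l2_inner_const_left l2_inner_const_right)
  then have "(l2_norm (const_fun c * f))\<^sup>2 = (norm c * l2_norm f)\<^sup>2"
    by (simp add: l2_norm_sq power_mult_distrib del: of_real_power)
  then show ?thesis
    by (metis power2_eq_iff_nonneg l2_norm_ge_0 mult_nonneg_nonneg norm_ge_zero)
qed

lemma l2_norm_uminus: "l2_norm (- f) = l2_norm f"
  using l2_norm_const[of "-1" f] by (simp add: const_fun_simps)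

lemma l2_norm_minus_commute: "l2_norm (f - g) = l2_norm (g - f)"
  using l2_norm_uminus[of "f - g"] by simp

text \<open>The squared norm of the component of \<open>f\<close> orthogonal to \<open>g\<close> is nonnegative.\<close>

lemma l2_Cauchy_Schwarz:
  assumes f: "f \<in> L2" and g: "g \<in> L2"
  shows "norm (l2_inner f g) \<le> l2_norm f * l2_norm g"
proof (cases "l2_norm g = 0")
  case True
  then show ?thesis using l2_norm_eq_0[OF g] by (simp add: l2_inner_zero)
next
  case False
  define N where "N = (l2_norm g)\<^sup>2"
  have N: "N > 0" using False by (simp add: N_def)
  define w where "w = l2_inner f g"
  define h where "h = f - const_fun (w / of_real N) * g"
  have gg: "l2_inner g g = of_real N" by (simp add: l2_inner_self_norm N_def)
  have gf: "l2_inner g f = cnj w" by (simp add: w_def flip: l2_inner_cnj)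
  have "l2_inner h h = l2_inner f f - w * cnj w / N"
    unfolding h_def using f g N
    by (simp add: l2_inner_diff_left l2_inner_diff_right L2_diff L2_const l2_inner_const_left
        l2_inner_const_right gf gg flip: w_def)
  also have "\<dots> = of_real ((l2_norm f)\<^sup>2 - (norm w)\<^sup>2 / N)"
    using N complex_norm_square[of w] by (simp add: l2_inner_self_norm)
  finally have "(l2_norm f)\<^sup>2 - (norm w)\<^sup>2 / N \<ge> 0"
    using l2_inner_self(2)[of h] by simp
  then have "(norm w)\<^sup>2 \<le> (l2_norm f)\<^sup>2 * N" using N by (simp add: field_simps)
  then have "(norm w)\<^sup>2 \<le> (l2_norm f * l2_norm g)\<^sup>2" by (simp add: N_def power_mult_distrib)
  then show ?thesis
    unfolding w_def using power2_le_imp_le[of "norm (l2_inner f g)"] by (simp add: l2_norm_ge_0)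
qed

lemma l2_triangle:
  assumes f: "f \<in> L2" and g: "g \<in> L2"
  shows "l2_norm (f + g) \<le> l2_norm f + l2_norm g"
proof -
  have "l2_inner (f + g) (f + g) = l2_inner f f + l2_inner g g + (l2_inner f g + cnj (l2_inner f g))"
    unfolding l2_inner_cnj[of g f, symmetric]
    using f g by (simp add: l2_inner_add_left l2_inner_add_right L2_add)
  then have "(l2_norm (f + g))\<^sup>2 = (l2_norm f)\<^sup>2 + (l2_norm g)\<^sup>2 + 2 * Re (l2_inner f g)"
    by (simp add: l2_norm_sq)
  also have "\<dots> \<le> (l2_norm f)\<^sup>2 + (l2_norm g)\<^sup>2 + 2 * (l2_norm f * l2_norm g)"
    using l2_Cauchy_Schwarz[OF f g] complex_Re_le_cmod[of "l2_inner f g"] by linarith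
  also have "\<dots> = (l2_norm f + l2_norm g)\<^sup>2" by (simp add: power2_sum)
  finally show ?thesis by (rule power2_le_imp_le) (simp add: l2_norm_ge_0)
qed

lemma l2_norm_flip: "l2_norm (flip f) = l2_norm f"
  by (simp add: l2_norm_def l2_inner_flip flip_simps)

text \<open>The bound is a parameter here, so that a single one can be used under transfer to representatives.\<close>

lift_definition ess_bound :: "circ_fun \<Rightarrow> real \<Rightarrow> bool" is "\<lambda>a C. AE z in circ. norm (a z) \<le> C"
proof (intro ext)
  fix f g :: "complex \<Rightarrow> complex" and C
  assume "f \<in> borel_measurable borel \<and> g \<in> borel_measurable borel \<and> (AE z in circ. f z = g z)"
  then show "(AE z in circ. norm (f z) \<le> C) = (AE z in circ. norm (g z) \<le> C)"
    by (auto elim!: AE_mp)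
qed

lemma Linf_ess_bound: "a \<in> Linf \<Longrightarrow> \<exists>C. ess_bound a C"
  unfolding Linf_def mem_Collect_eq by transfer simp

lemma l2_inner_mult_bound:
  assumes "f \<in> L2" "ess_bound a C"
  shows "Re (l2_inner (a * f) (a * f)) \<le> (max 0 C)\<^sup>2 * Re (l2_inner f f)"
  using assms unfolding L2_def mem_Collect_eq
proof transfer
  fix a f :: "complex \<Rightarrow> complex" and C
  assume meas: "f \<in> borel_measurable borel \<and> f \<in> borel_measurable borel \<and> (AE z in circ. f z = f z)"
    "a \<in> borel_measurable borel \<and> a \<in> borel_measurable borel \<and> (AE z in circ. a z = a z)"
  from meas have [measurable]: "f \<in> borel_measurable borel" "a \<in> borel_measurable borel" by simp_all
  assume i: "integrable circ (\<lambda>z. (norm (f z))\<^sup>2)" and C: "AE z in circ. norm (a z) \<le> C"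
  have r: "Re (\<integral>z. g z * cnj (g z) \<partial>circ) = (\<integral>z. (norm (g z))\<^sup>2 \<partial>circ)" for g :: "complex \<Rightarrow> complex"
    by (simp del: of_real_power flip: complex_norm_square)
  have "AE z in circ. (norm (a z * f z))\<^sup>2 \<le> (max 0 C)\<^sup>2 * (norm (f z))\<^sup>2"
    using C by eventually_elim (auto simp: norm_mult power_mult_distrib intro!: mult_right_mono power_mono)
  then have "(\<integral>z. (norm (a z * f z))\<^sup>2 \<partial>circ) \<le> (\<integral>z. (max 0 C)\<^sup>2 * (norm (f z))\<^sup>2 \<partial>circ)"
    by (intro integral_mono_AE') (use i in auto)
  then show "Re (\<integral>z. a z * f z * cnj (a z * f z) \<partial>circ) \<le> (max 0 C)\<^sup>2 * Re (\<integral>z. f z * cnj (f z) \<partial>circ)"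
    unfolding r by simp
qed

lemma l2_norm_mult_bounded:
  assumes "a \<in> Linf"
  shows "\<exists>C\<ge>0. \<forall>f\<in>L2. l2_norm (a * f) \<le> C * l2_norm f"
proof -
  obtain C where C: "ess_bound a C" using Linf_ess_bound[OF assms] by blast
  have "l2_norm (a * f) \<le> max 0 C * l2_norm f" if "f \<in> L2" for f
    using real_sqrt_le_mono[OF l2_inner_mult_bound[OF that C]] by (simp add: l2_norm_def real_sqrt_mult)
  then show ?thesis by (intro exI[of _ "max 0 C"]) simp
qed

section \<open>Completeness of the space of square integrable functions\<close>

text \<open>The argument of Riesz and Fischer on representatives.  A subsequence whose consecutive distances decay
  geometrically has summable increments at almost every point, because on a probability space the first
  moment is controlled by the second one.  Fatou's lemma identifies its pointwise limit as the mean
  square limit of the whole sequence.\<close>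

lemma square_integrable_complete:
  fixes x :: "nat \<Rightarrow> complex \<Rightarrow> complex"
  assumes [measurable]: "\<And>n. x n \<in> borel_measurable borel"
    and i: "\<And>n. integrable circ (\<lambda>z. (norm (x n z))\<^sup>2)"
    and C: "\<And>e. e > 0 \<Longrightarrow> \<exists>N. \<forall>m\<ge>N. \<forall>n\<ge>N. (\<integral>z. (norm (x m z - x n z))\<^sup>2 \<partial>circ) < e"
  shows "\<exists>p\<in>borel_measurable borel. integrable circ (\<lambda>z. (norm (p z))\<^sup>2) \<and>
    (\<forall>e>0. \<exists>N. \<forall>n\<ge>N. (\<integral>z. (norm (x n z - p z))\<^sup>2 \<partial>circ) \<le> e)"
proof -
  have i2: "integrable circ (\<lambda>z. (norm (x m z - x n z))\<^sup>2)" for m n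
    by (rule integrable_sq_bound[OF _ i[of m] i[of n], of _ 2])
       (use sq_sum_le[of "x m _" "- x n _"] in \<open>simp_all add: norm_minus_commute\<close>)
  have "\<exists>N. \<forall>k. (\<forall>m\<ge>N k. \<forall>n\<ge>N k. (\<integral>z. (norm (x m z - x n z))\<^sup>2 \<partial>circ) < (1/4)^k) \<and> N k \<ge> k \<and> N (Suc k) \<ge> N k"
  proof -
    have "\<forall>k. \<exists>N. \<forall>m\<ge>N. \<forall>n\<ge>N. (\<integral>z. (norm (x m z - x n z))\<^sup>2 \<partial>circ) < (1/4)^k"
      using C by simp
    then obtain N0 where N0: "\<And>k. \<forall>m\<ge>N0 k. \<forall>n\<ge>N0 k. (\<integral>z. (norm (x m z - x n z))\<^sup>2 \<partial>circ) < (1/4)^k"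
      by metis
    \<comment> \<open>The sum makes the indices monotone and unbounded.\<close>
    define N where "N k = k + (\<Sum>j\<le>k. N0 j)" for k
    have "N0 k \<le> N k" for k unfolding N_def by (cases k) auto
    then have "(\<forall>m\<ge>N k. \<forall>n\<ge>N k. (\<integral>z. (norm (x m z - x n z))\<^sup>2 \<partial>circ) < (1/4)^k)" for k
      using N0[of k] order_trans by blast
    moreover have "N k \<ge> k \<and> N (Suc k) \<ge> N k" for k by (simp add: N_def)
    ultimately show ?thesis by blast
  qed
  then obtain N where N: "\<And>k m n. m \<ge> N k \<Longrightarrow> n \<ge> N k \<Longrightarrow> (\<integral>z. (norm (x m z - x n z))\<^sup>2 \<partial>circ) < (1/4)^k"
    and Nge: "\<And>k. N k \<ge> k" "\<And>k. N (Suc k) \<ge> N k" by blast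
  define y where "y k = x (N k)" for k
  have [measurable]: "y k \<in> borel_measurable borel" for k by (simp add: y_def)
  define g where "g k z = norm (y (Suc k) z - y k z)" for k z
  have [measurable]: "g k \<in> borel_measurable borel" for k unfolding g_def by measurable
  have g1: "(\<integral>\<^sup>+z. ennreal (g k z) \<partial>circ) \<le> ennreal ((1/2)^k)" for k
  proof -
    have "(\<integral>\<^sup>+z. ennreal (g k z) \<partial>circ) \<le> (\<integral>\<^sup>+z. ennreal ((1/2)^k / 2 + 2^k / 2 * (g k z)\<^sup>2) \<partial>circ)"
    proof (intro nn_integral_mono ennreal_leI)
      fix z
      \<comment> \<open>Arithmetic-geometric mean inequality, weighted to match the decay of the second moments.\<close>
      have "0 \<le> (2^k * g k z - 1)\<^sup>2 / (2 * 2^k)" by simp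
      also have "\<dots> = (1/2)^k / 2 + 2^k / 2 * (g k z)\<^sup>2 - g k z"
        by (simp add: power2_eq_square field_simps power_divide)
      finally show "g k z \<le> (1/2)^k / 2 + 2^k / 2 * (g k z)\<^sup>2" by simp
    qed
    also have "\<dots> = ennreal (\<integral>z. (1/2)^k / 2 + 2^k / 2 * (g k z)\<^sup>2 \<partial>circ)"
      by (rule nn_integral_eq_integral) (use i2[of "N (Suc k)" "N k"] in \<open>auto simp: g_def y_def\<close>)
    also have "(\<integral>z. (1/2)^k / 2 + 2^k / 2 * (g k z)\<^sup>2 \<partial>circ) = (1/2)^k / 2 + 2^k / 2 * (\<integral>z. (g k z)\<^sup>2 \<partial>circ)"
      using i2[of "N (Suc k)" "N k"] by (simp add: g_def y_def measure_circ)
    also have "ennreal \<dots> \<le> ennreal ((1/2)^k / 2 + 2^k / 2 * (1/4)^k)"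
      using N[of k "N (Suc k)" "N k"] Nge(2)[of k]
      by (intro ennreal_leI add_left_mono mult_left_mono) (auto simp: g_def y_def)
    also have "(1/2)^k / 2 + 2^k / 2 * (1/4)^k = (1/2 :: real)^k"
    proof -
      have "(2::real)^k * (1/4)^k = (1/2)^k" by (simp flip: power_mult_distrib)
      then show ?thesis by simp
    qed
    finally show ?thesis .
  qed
  have "(\<integral>\<^sup>+z. (\<Sum>k. ennreal (g k z)) \<partial>circ) = (\<Sum>k. \<integral>\<^sup>+z. ennreal (g k z) \<partial>circ)"
    by (rule nn_integral_suminf) simp
  also have "\<dots> \<le> (\<Sum>k. ennreal ((1/2)^k))" by (intro suminf_le g1) auto
  also have "\<dots> = ennreal (\<Sum>k. (1/2)^k)" by (rule suminf_ennreal2) auto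
  also have "\<dots> < \<infinity>" by simp
  finally have "AE z in circ. (\<Sum>k. ennreal (g k z)) \<noteq> \<infinity>"
    by (intro nn_integral_PInf_AE) auto
  then have conv: "AE z in circ. convergent (\<lambda>k. y k z)"
  proof eventually_elim
    case (elim z)
    then have "summable (\<lambda>k. g k z)"
      by (intro summable_suminf_not_top) (auto simp: g_def)
    then have "summable (\<lambda>k. y (Suc k) z - y k z)" unfolding g_def by (rule summable_norm_cancel)
    then have "convergent (\<lambda>n. \<Sum>k<n. y (Suc k) z - y k z)" by (simp add: summable_iff_convergent)
    then have "convergent (\<lambda>n. (y n z - y 0 z) + y 0 z)"
      using sum_lessThan_telescope[of "\<lambda>k. y k z"] by (subst convergent_add_const_right_iff) simp
    then show ?case by simp
  qed
  define p where "p z = lim (\<lambda>k. y k z)" for z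
  have [measurable]: "p \<in> borel_measurable borel" unfolding p_def by measurable
  have fatou: "(\<integral>\<^sup>+z. ennreal ((norm (x n z - p z))\<^sup>2) \<partial>circ) \<le> ennreal e"
    if M: "\<And>m n. m \<ge> M \<Longrightarrow> n \<ge> M \<Longrightarrow> (\<integral>z. (norm (x m z - x n z))\<^sup>2 \<partial>circ) < e" and n: "n \<ge> M" for n M e
  proof -
    have "(\<integral>\<^sup>+z. ennreal ((norm (x n z - p z))\<^sup>2) \<partial>circ) = (\<integral>\<^sup>+z. liminf (\<lambda>k. ennreal ((norm (x n z - y k z))\<^sup>2)) \<partial>circ)"
    proof (rule nn_integral_cong_AE)
      show "AE z in circ. ennreal ((norm (x n z - p z))\<^sup>2) = liminf (\<lambda>k. ennreal ((norm (x n z - y k z))\<^sup>2))"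
        using conv
      proof eventually_elim
        case (elim z)
        then have "(\<lambda>k. y k z) \<longlonglongrightarrow> p z" by (simp add: p_def convergent_LIMSEQ_iff)
        then have "(\<lambda>k. ennreal ((norm (x n z - y k z))\<^sup>2)) \<longlonglongrightarrow> ennreal ((norm (x n z - p z))\<^sup>2)"
          by (intro tendsto_intros tendsto_ennrealI)
        then show ?case by (rule lim_imp_Liminf[OF sequentially_bot, symmetric])
      qed
    qed
    also have "\<dots> \<le> liminf (\<lambda>k. \<integral>\<^sup>+z. ennreal ((norm (x n z - y k z))\<^sup>2) \<partial>circ)"
      by (rule nn_integral_liminf) simp
    also have "\<dots> \<le> liminf (\<lambda>k. ennreal e)"
    proof (rule Liminf_mono)
      show "\<forall>\<^sub>F k in sequentially. (\<integral>\<^sup>+z. ennreal ((norm (x n z - y k z))\<^sup>2) \<partial>circ) \<le> ennreal e"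
        using eventually_ge_at_top[of M]
      proof eventually_elim
        case (elim k)
        then have "N k \<ge> M" using Nge(1)[of k] by simp
        then have "(\<integral>z. (norm (x n z - y k z))\<^sup>2 \<partial>circ) \<le> e" using M[of n "N k"] n by (simp add: y_def)
        moreover have "(\<integral>\<^sup>+z. ennreal ((norm (x n z - y k z))\<^sup>2) \<partial>circ) = ennreal (\<integral>z. (norm (x n z - y k z))\<^sup>2 \<partial>circ)"
          by (rule nn_integral_eq_integral) (use i2 in \<open>auto simp: y_def\<close>)
        ultimately show ?case by (simp add: ennreal_leI)
      qed
    qed
    finally show ?thesis by (simp add: Liminf_const)
  qed
  have ip: "integrable circ (\<lambda>z. (norm (x n z - p z))\<^sup>2) \<and> (\<integral>z. (norm (x n z - p z))\<^sup>2 \<partial>circ) \<le> e"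
    if M: "\<And>m n. m \<ge> M \<Longrightarrow> n \<ge> M \<Longrightarrow> (\<integral>z. (norm (x m z - x n z))\<^sup>2 \<partial>circ) < e" and n: "n \<ge> M" and e: "e > 0" for n M e
  proof
    show ii: "integrable circ (\<lambda>z. (norm (x n z - p z))\<^sup>2)"
      by (rule integrableI_nonneg) (use fatou[of M e n] M n in \<open>auto simp: le_less_trans\<close>)
    have "ennreal (\<integral>z. (norm (x n z - p z))\<^sup>2 \<partial>circ) \<le> ennreal e"
      using fatou[OF M n] nn_integral_eq_integral[OF ii] by simp
    then show "(\<integral>z. (norm (x n z - p z))\<^sup>2 \<partial>circ) \<le> e" using e by (simp add: ennreal_le_iff)
  qed
  show ?thesis
  proof (intro bexI[of _ p] conjI allI impI)
    obtain M where M: "\<And>m n. m \<ge> M \<Longrightarrow> n \<ge> M \<Longrightarrow> (\<integral>z. (norm (x m z - x n z))\<^sup>2 \<partial>circ) < 1"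
      using C[of 1] by auto
    then have iM: "integrable circ (\<lambda>z. (norm (x M z - p z))\<^sup>2)" using ip[of M 1 M] by simp
    have "(norm (p z))\<^sup>2 \<le> 2 * ((norm (x M z - p z))\<^sup>2 + (norm (x M z))\<^sup>2)" for z
      using sq_sum_le[of "p z - x M z" "x M z"] by (simp add: norm_minus_commute)
    then show "integrable circ (\<lambda>z. (norm (p z))\<^sup>2)"
      by (intro integrable_sq_bound[OF _ iM i[of M], of _ 2]) simp_all
  next
    fix e :: real assume e: "e > 0"
    then show "\<exists>N. \<forall>n\<ge>N. (\<integral>z. (norm (x n z - p z))\<^sup>2 \<partial>circ) \<le> e"
      using C[OF e] ip[of _ e] by meson
  qed simp
qed

lemma circ_fun_cases: obtains f where "f \<in> borel_measurable borel" "F = abs_circ_fun f"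
  by (induct F rule: circ_fun.abs_induct) auto

lemma l2_norm_sq_abs:
  assumes "f \<in> borel_measurable borel"
  shows "(l2_norm (abs_circ_fun f))\<^sup>2 = (\<integral>z. (norm (f z))\<^sup>2 \<partial>circ)"
proof -
  have "l2_inner (abs_circ_fun f) (abs_circ_fun f) = (\<integral>z. f z * cnj (f z) \<partial>circ)"
    using assms by (simp add: l2_inner.abs_eq)
  then show ?thesis
    by (simp add: l2_norm_sq del: of_real_power flip: complex_norm_square)
qed

lemma L2_complete:
  assumes L2: "\<And>n :: nat. X n \<in> L2"
    and C: "\<And>e. e > 0 \<Longrightarrow> \<exists>N. \<forall>m\<ge>N. \<forall>n\<ge>N. (l2_norm (X m - X n))\<^sup>2 < e"
  shows "\<exists>p\<in>L2. (\<lambda>n. l2_norm (X n - p)) \<longlonglongrightarrow> 0"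
proof -
  have "\<forall>n. \<exists>x. x \<in> borel_measurable borel \<and> X n = abs_circ_fun x"
    by (meson circ_fun_cases)
  then obtain x where x [measurable]: "\<And>n. x n \<in> borel_measurable borel" and X: "\<And>n. X n = abs_circ_fun (x n)"
    by metis
  have i: "integrable circ (\<lambda>z. (norm (x n z))\<^sup>2)" for n
    using L2[of n] unfolding L2_def X by (simp add: square_integrable.abs_eq)
  have "l2_norm (X m - abs_circ_fun p) ^ 2 = (\<integral>z. (norm (x m z - p z))\<^sup>2 \<partial>circ)"
    if [measurable]: "p \<in> borel_measurable borel" for m p
    unfolding X by (simp add: minus_circ_fun.abs_eq l2_norm_sq_abs)
  note d = this
  have dX: "(l2_norm (X m - X n))\<^sup>2 = (\<integral>z. (norm (x m z - x n z))\<^sup>2 \<partial>circ)" for m n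
    using d[OF x[of n], of m] unfolding X[of n] .
  obtain p where p [measurable]: "p \<in> borel_measurable borel" and ip: "integrable circ (\<lambda>z. (norm (p z))\<^sup>2)"
    and lim: "\<And>e. e > 0 \<Longrightarrow> \<exists>N. \<forall>n\<ge>N. (\<integral>z. (norm (x n z - p z))\<^sup>2 \<partial>circ) \<le> e"
    using square_integrable_complete[of x, OF x i C[unfolded dX]] by auto
  show ?thesis
  proof (intro bexI[of _ "abs_circ_fun p"])
    show "abs_circ_fun p \<in> L2" using ip p by (simp add: L2_def square_integrable.abs_eq)
    show "(\<lambda>n. l2_norm (X n - abs_circ_fun p)) \<longlonglongrightarrow> 0"
    proof (rule LIMSEQ_I)
      fix e :: real assume e: "e > 0"
      then obtain N where N: "\<And>n. n \<ge> N \<Longrightarrow> (l2_norm (X n - abs_circ_fun p))\<^sup>2 \<le> (e/2)\<^sup>2"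
        using lim[of "(e/2)\<^sup>2"] d[OF p] by auto
      have "l2_norm (X n - abs_circ_fun p) < e" if "n \<ge> N" for n
        using power2_le_imp_le[OF N[OF that]] e by simp
      then show "\<exists>N. \<forall>n\<ge>N. norm (l2_norm (X n - abs_circ_fun p) - 0) < e"
        by (auto simp: l2_norm_ge_0)
    qed
  qed
qed

section \<open>Bessel and Riesz-Fischer\<close>

text \<open>Mean square convergence implies weak convergence.\<close>

lemma tendsto_l2_inner:
  assumes "\<And>n :: nat. X n \<in> L2" "p \<in> L2" "g \<in> L2" "(\<lambda>n. l2_norm (X n - p)) \<longlonglongrightarrow> 0"
  shows "(\<lambda>n. l2_inner (X n) g) \<longlonglongrightarrow> l2_inner p g"
proof (rule LIM_zero_cancel)
  show "(\<lambda>n. l2_inner (X n) g - l2_inner p g) \<longlonglongrightarrow> 0"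
  proof (rule Lim_null_comparison)
    show "\<forall>\<^sub>F n in sequentially. norm (l2_inner (X n) g - l2_inner p g) \<le> l2_norm (X n - p) * l2_norm g"
      using assms l2_Cauchy_Schwarz[of "X _ - p" g]
      by (intro always_eventually) (auto simp: L2_diff simp flip: l2_inner_diff_left)
    show "(\<lambda>n. l2_norm (X n - p) * l2_norm g) \<longlonglongrightarrow> 0"
      using tendsto_mult_left_zero[OF assms(4)] by simp
  qed
qed

definition trig_sum :: "(int \<Rightarrow> complex) \<Rightarrow> int set \<Rightarrow> circ_fun" where
  "trig_sum c I = (\<Sum>n\<in>I. const_fun (c n) * zpow n)"

lemma trig_sum_L2: "trig_sum c I \<in> L2"
  unfolding trig_sum_def by (intro L2_sum L2_const zpow_L2)

lemma l2_inner_trig_sum_left: "f \<in> L2 \<Longrightarrow> l2_inner (trig_sum c I) f = (\<Sum>n\<in>I. c n * cnj (fourier_coeff f n))"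
  unfolding trig_sum_def
  by (subst l2_inner_sum_left)
     (auto intro!: sum.cong L2_const zpow_L2 simp: l2_inner_const_left fourier_coeff_conv_inner l2_inner_cnj[of "zpow _" f])

lemma fourier_coeff_trig_sum: "finite I \<Longrightarrow> fourier_coeff (trig_sum c I) n = (if n \<in> I then c n else 0)"
  unfolding fourier_coeff_conv_inner trig_sum_def
  by (subst l2_inner_sum_left)
     (auto intro!: L2_const zpow_L2 simp: l2_inner_const_left l2_inner_zpow if_distrib cong: if_cong)

lemma l2_norm_trig_sum: "finite I \<Longrightarrow> (l2_norm (trig_sum c I))\<^sup>2 = (\<Sum>n\<in>I. (norm (c n))\<^sup>2)"
proof -
  assume I: "finite I"
  have "l2_inner (trig_sum c I) (trig_sum c I) = (\<Sum>n\<in>I. c n * cnj (c n))"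
    by (subst l2_inner_trig_sum_left) (auto simp: trig_sum_L2 fourier_coeff_trig_sum I intro: sum.cong)
  also have "\<dots> = of_real (\<Sum>n\<in>I. (norm (c n))\<^sup>2)" unfolding of_real_sum complex_norm_square ..
  finally show ?thesis by (simp add: l2_norm_sq)
qed

lemma trig_sum_diff: "finite J \<Longrightarrow> I \<subseteq> J \<Longrightarrow> trig_sum c J - trig_sum c I = trig_sum c (J - I)"
  unfolding trig_sum_def by (simp add: sum_diff)

text \<open>The difference of \<open>f\<close> and its partial sum \<open>s\<close> has squared norm \<open>\<parallel>f\<parallel>\<^sup>2 - \<parallel>s\<parallel>\<^sup>2\<close>.\<close>

lemma Bessel:
  assumes f: "f \<in> L2" and I: "finite I"
  shows "(\<Sum>n\<in>I. (norm (fourier_coeff f n))\<^sup>2) \<le> (l2_norm f)\<^sup>2"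
proof -
  define s where "s = trig_sum (fourier_coeff f) I"
  have sL: "s \<in> L2" by (simp add: s_def trig_sum_L2)
  have "l2_inner s f = (\<Sum>n\<in>I. fourier_coeff f n * cnj (fourier_coeff f n))"
    unfolding s_def by (rule l2_inner_trig_sum_left[OF f])
  also have "\<dots> = of_real ((l2_norm s)\<^sup>2)"
    unfolding s_def l2_norm_trig_sum[OF I] of_real_sum complex_norm_square ..
  finally have sf: "l2_inner s f = of_real ((l2_norm s)\<^sup>2)" .
  then have fs: "l2_inner f s = of_real ((l2_norm s)\<^sup>2)" by (subst l2_inner_cnj) simp
  have "l2_inner (f - s) (f - s) = of_real ((l2_norm f)\<^sup>2 - (l2_norm s)\<^sup>2)"
    using f sL
    by (simp add: l2_inner_diff_left l2_inner_diff_right L2_diff sf fs flip: l2_inner_self_norm)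
       (simp add: l2_inner_self_norm)
  then have "(l2_norm f)\<^sup>2 - (l2_norm s)\<^sup>2 \<ge> 0"
    using l2_inner_self(2)[of "f - s"] by simp
  then show ?thesis by (simp add: s_def l2_norm_trig_sum[OF I])
qed

text \<open>Squared distances of the symmetric partial sums are differences of a bounded monotone sequence, hence the
  partial sums are Cauchy.  All existence statements below (projection, representing vector) rest on this
  construction.\<close>

lemma Riesz_Fischer:
  assumes B: "\<And>N :: nat. (\<Sum>n\<in>{- int N..int N}. (norm (c n))\<^sup>2) \<le> B"
  shows "\<exists>p\<in>L2. (\<forall>n. fourier_coeff p n = c n) \<and>
    (\<lambda>N. l2_norm (trig_sum c {- int N..int N} - p)) \<longlonglongrightarrow> 0"
proof -
  define I where "I N = {- int N..int N}" for N :: nat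
  define a where "a N = (\<Sum>n\<in>I N. (norm (c n))\<^sup>2)" for N
  have I [simp]: "finite (I N)" for N by (simp add: I_def)
  have mono: "I M \<subseteq> I N" if "M \<le> N" for M N using that by (auto simp: I_def)
  have "incseq a" unfolding a_def by (intro incseq_SucI sum_mono2 mono) auto
  then obtain l where "a \<longlonglongrightarrow> l" using incseq_convergent[of a B] B unfolding a_def I_def by blast
  then have "Cauchy a" by (rule LIMSEQ_imp_Cauchy)
  have d: "(l2_norm (trig_sum c (I m) - trig_sum c (I n)))\<^sup>2 = norm (a m - a n)" for m n
  proof -
    have *: "(l2_norm (trig_sum c (I m) - trig_sum c (I n)))\<^sup>2 = a m - a n \<and> a m - a n \<ge> 0" if "n \<le> m" for m n
      using mono[OF that] sum_diff[OF _ mono[OF that], of "\<lambda>n. (norm (c n))\<^sup>2"]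
      by (simp add: trig_sum_diff l2_norm_trig_sum a_def sum_nonneg flip: sum_diff)
    show ?thesis
      using *[of n m] *[of m n] l2_norm_minus_commute[of "trig_sum c (I m)" "trig_sum c (I n)"]
      by (cases "n \<le> m") auto
  qed
  have "\<exists>p\<in>L2. (\<lambda>N. l2_norm (trig_sum c (I N) - p)) \<longlonglongrightarrow> 0"
  proof (rule L2_complete)
    show "\<exists>N. \<forall>m\<ge>N. \<forall>n\<ge>N. (l2_norm (trig_sum c (I m) - trig_sum c (I n)))\<^sup>2 < e" if "e > 0" for e
      unfolding d using CauchyD[OF \<open>Cauchy a\<close> that] by simp
  qed (rule trig_sum_L2)
  then obtain p where p: "p \<in> L2" and lim: "(\<lambda>N. l2_norm (trig_sum c (I N) - p)) \<longlonglongrightarrow> 0" by blast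
  have "fourier_coeff p n = c n" for n
  proof -
    have "(\<lambda>N. fourier_coeff (trig_sum c (I N)) n) \<longlonglongrightarrow> fourier_coeff p n"
      unfolding fourier_coeff_conv_inner by (rule tendsto_l2_inner[OF trig_sum_L2 p zpow_L2 lim])
    moreover have "(\<lambda>N. fourier_coeff (trig_sum c (I N)) n) \<longlonglongrightarrow> c n"
    proof (rule tendsto_eventually)
      show "\<forall>\<^sub>F N in sequentially. fourier_coeff (trig_sum c (I N)) n = c n"
        using eventually_ge_at_top[of "nat \<bar>n\<bar>"]
        by eventually_elim (auto simp: fourier_coeff_trig_sum I_def)
    qed
    ultimately show ?thesis by (rule LIMSEQ_unique)
  qed
  with p lim show ?thesis by (auto simp: I_def)
qed

section \<open>Uniqueness of Fourier coefficients\<close>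

text \<open>All Fourier coefficients vanish.  Measurability and integrability are included, so that the property is
  inherited by products with polynomials.\<close>

definition annihilates_powers :: "(complex \<Rightarrow> complex) \<Rightarrow> bool" where
  "annihilates_powers f \<longleftrightarrow> f \<in> borel_measurable borel \<and> integrable circ f \<and> (\<forall>n::int. (\<integral>z. f z * z powi n \<partial>circ) = 0)"

lemma integrable_mult_powi:
  fixes f :: "complex \<Rightarrow> complex"
  assumes f: "integrable circ f"
  shows "integrable circ (\<lambda>z. f z * z powi n)"
proof (rule Bochner_Integration.integrable_bound[OF f])
  show "AE z in circ. norm (f z * z powi n) \<le> norm (f z)"
    using AE_circ_norm by eventually_elim (simp add: norm_mult norm_power_int)
qed (use f in measurable)

lemma annihilates_cong_AE:
  assumes "annihilates_powers f" "g \<in> borel_measurable borel" "AE z in circ. g z = f z"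
  shows "annihilates_powers g"
proof -
  have f [measurable]: "f \<in> borel_measurable borel" using assms(1) by (simp add: annihilates_powers_def)
  note [measurable] = assms(2)
  have "integrable circ g \<longleftrightarrow> integrable circ f" using assms(3) by (intro integrable_cong_AE) simp_all
  moreover have "(\<integral>z. g z * z powi n \<partial>circ) = (\<integral>z. f z * z powi n \<partial>circ)" for n
    by (intro integral_cong_AE) (use assms(3) in \<open>auto elim: AE_mp\<close>)
  ultimately show ?thesis using assms by (simp add: annihilates_powers_def)
qed

lemma annihilates_add: "annihilates_powers f \<Longrightarrow> annihilates_powers g \<Longrightarrow> annihilates_powers (\<lambda>z. f z + g z)"
  unfolding annihilates_powers_def by (auto simp: ring_distribs integrable_mult_powi)

lemma annihilates_scale: "annihilates_powers f \<Longrightarrow> annihilates_powers (\<lambda>z. c * f z)"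
  unfolding annihilates_powers_def by (auto simp: mult.assoc)

lemma annihilates_powi: "annihilates_powers f \<Longrightarrow> annihilates_powers (\<lambda>z. f z * z powi k)"
proof -
  assume f: "annihilates_powers f"
  then have [measurable]: "f \<in> borel_measurable borel" by (simp add: annihilates_powers_def)
  have "(\<integral>z. f z * z powi k * z powi n \<partial>circ) = (\<integral>z. f z * z powi (k + n) \<partial>circ)" for n
  proof (intro integral_cong_AE)
    show "AE z in circ. f z * z powi k * z powi n = f z * z powi (k + n)"
      using AE_circ_norm
    proof eventually_elim
      case (elim z)
      then have "z \<noteq> 0" by auto
      then show ?case by (simp add: power_int_add mult.assoc)
    qed
  qed simp_all
  then show ?thesis using f unfolding annihilates_powers_def by (auto simp: integrable_mult_powi)
qed

text \<open>Quantifying over \<open>f\<close> turns products of polynomials into iterated multiplications.  On the circle a real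
  linear form is a combination of \<open>z\<close> and its inverse, and these only shift the coefficients.\<close>

lemma annihilates_mult_real_polynomial:
  assumes "real_polynomial_function p" "annihilates_powers f"
  shows "annihilates_powers (\<lambda>z. f z * of_real (p z))"
  using assms
proof (induction arbitrary: f)
  case (linear p)
  define a where "a = (of_real (p 1) - \<i> * of_real (p \<i>)) / 2"
  define b where "b = (of_real (p 1) + \<i> * of_real (p \<i>)) / 2"
  have p: "p z = Re z * p 1 + Im z * p \<i>" for z
  proof -
    have "z = Re z *\<^sub>R 1 + Im z *\<^sub>R \<i>" by (simp add: complex_eq_iff)
    then have "p z = p (Re z *\<^sub>R 1 + Im z *\<^sub>R \<i>)" by simp
    then show ?thesis
      using linear(1) by (simp add: linear_add linear_scale bounded_linear.linear del: scaleR_complex.code)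
  qed
  have ab: "of_real (p z) = a * z + b * cnj z" for z
    unfolding a_def b_def by (subst p) (simp add: complex_eq_iff field_simps)
  have "annihilates_powers (\<lambda>z. a * (f z * z powi 1) + b * (f z * z powi (-1)))"
    using linear(2) by (intro annihilates_add annihilates_scale annihilates_powi)
  moreover have "(\<lambda>z. f z * of_real (p z)) \<in> borel_measurable borel"
  proof -
    have [measurable]: "f \<in> borel_measurable borel" using linear(2) by (simp add: annihilates_powers_def)
    show ?thesis unfolding ab by (intro borel_measurable_times borel_measurable_add) measurable
  qed
  moreover have "AE z in circ. f z * of_real (p z) = a * (f z * z powi 1) + b * (f z * z powi (-1))"
    using AE_circ_norm
  proof eventually_elim
    case (elim z)
    then have "cnj z = z powi (-1)" using cnj_powi[of z 1] by simp
    then show ?case by (simp add: ab algebra_simps)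
  qed
  ultimately show ?case by (rule annihilates_cong_AE)
next
  case (const c)
  then show ?case using annihilates_scale[of f "of_real c"] by (simp add: mult.commute)
next
  case (add p q)
  have "annihilates_powers (\<lambda>z. f z * of_real (p z) + f z * of_real (q z))"
    by (intro annihilates_add add.IH add.prems)
  then show ?case by (simp add: ring_distribs)
next
  case (mult p q)
  have "annihilates_powers (\<lambda>z. (f z * of_real (p z)) * of_real (q z))"
    by (intro mult.IH mult.prems)
  then show ?case by (simp add: mult.assoc)
qed

text \<open>Stone-Weierstrass on the circle: real polynomials in the plane approximate continuous functions uniformly.\<close>

lemma annihilates_continuous:
  assumes f: "annihilates_powers f" and h: "continuous_on UNIV h"
  shows "(\<integral>z. f z * of_real (h z :: real) \<partial>circ) = 0"
proof -
  have [measurable]: "f \<in> borel_measurable borel" and i: "integrable circ f"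
    using f by (auto simp: annihilates_powers_def)
  have [measurable]: "h \<in> borel_measurable borel" using h by (rule borel_measurable_continuous_onI)
  have "norm (\<integral>z. f z * of_real (h z) \<partial>circ) \<le> e * (\<integral>z. norm (f z) \<partial>circ)" if e: "e > 0" for e
  proof -
    obtain p where p: "real_polynomial_function p" and close: "\<And>z. z \<in> sphere 0 1 \<Longrightarrow> \<bar>h z - p z\<bar> < e"
      using Stone_Weierstrass_real_polynomial_function[OF compact_sphere continuous_on_subset[OF h subset_UNIV] e]
      by metis
    have fp: "annihilates_powers (\<lambda>z. f z * of_real (p z))" by (rule annihilates_mult_real_polynomial[OF p f])
    then have ip: "integrable circ (\<lambda>z. f z * of_real (p z))" and ip0: "(\<integral>z. f z * of_real (p z) \<partial>circ) = 0"
      unfolding annihilates_powers_def by (blast, metis (no_types, lifting) Bochner_Integration.integral_cong mult.right_neutral power_int_0_right)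
    have [measurable]: "(\<lambda>z. f z * of_real (p z)) \<in> borel_measurable borel" using fp by (simp add: annihilates_powers_def)
    have bd: "AE z in circ. norm (f z * of_real (h z) - f z * of_real (p z)) \<le> norm (e * norm (f z))"
      using AE_circ_norm
    proof eventually_elim
      case (elim z)
      have "norm (f z * of_real (h z) - f z * of_real (p z)) = norm (f z) * \<bar>h z - p z\<bar>"
        by (simp flip: right_diff_distrib of_real_diff add: norm_mult)
      also have "\<dots> \<le> norm (f z) * e"
        using close[of z] elim by (intro mult_left_mono) auto
      finally show ?case using e by (simp add: mult.commute)
    qed
    have "integrable circ (\<lambda>z. e * norm (f z))" using i by simp
    then have id: "integrable circ (\<lambda>z. f z * of_real (h z) - f z * of_real (p z))"
      by (rule Bochner_Integration.integrable_bound[OF _ _ bd]) measurable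
    have "(\<integral>z. f z * of_real (h z) \<partial>circ) =
        (\<integral>z. (f z * of_real (h z) - f z * of_real (p z)) + f z * of_real (p z) \<partial>circ)" by simp
    also have "\<dots> = (\<integral>z. f z * of_real (h z) - f z * of_real (p z) \<partial>circ)"
      using ip0 by (subst Bochner_Integration.integral_add[OF id ip]) simp
    also have "norm \<dots> \<le> (\<integral>z. norm (f z * of_real (h z) - f z * of_real (p z)) \<partial>circ)"
      by (rule integral_norm_bound)
    also have "\<dots> \<le> (\<integral>z. e * norm (f z) \<partial>circ)"
      by (rule integral_mono_AE) (use id i bd e in auto)
    finally show ?thesis by simp
  qed
  note * = this
  have "(\<lambda>n. inverse (real (Suc n)) * (\<integral>z. norm (f z) \<partial>circ)) \<longlonglongrightarrow> 0 * (\<integral>z. norm (f z) \<partial>circ)"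
    by (intro tendsto_intros LIMSEQ_inverse_real_of_nat)
  then have "norm (\<integral>z. f z * of_real (h z) \<partial>circ) \<le> 0 * (\<integral>z. norm (f z) \<partial>circ)"
    by (rule LIMSEQ_le_const) (use * in \<open>auto simp del: of_nat_Suc\<close>)
  then show ?thesis by simp
qed

text \<open>The indicator of a closed set is the pointwise limit of the continuous tent functions \<open>h n\<close>.\<close>

lemma annihilates_closed:
  assumes f: "annihilates_powers f" and C: "closed C"
  shows "(\<integral>z. f z * indicator C z \<partial>circ) = 0"
\<comment> \<open>The distance to the empty set is zero by convention, so this set is treated apart.\<close>
proof (cases "C = {}")
  case False
  have [measurable]: "f \<in> borel_measurable borel" and i: "integrable circ f"
    using f by (auto simp: annihilates_powers_def)
  have [measurable]: "C \<in> sets borel" using C by simp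
  define h where "h n z = max 0 (1 - real n * infdist z C)" for n z
  have cont: "continuous_on UNIV (h n)" for n
    unfolding h_def by (intro continuous_intros)
  have [measurable]: "h n \<in> borel_measurable borel" for n using cont by (rule borel_measurable_continuous_onI)
  have h01: "0 \<le> h n z" "h n z \<le> 1" for n z by (auto simp: h_def infdist_nonneg)
  have "(\<lambda>n. \<integral>z. f z * of_real (h n z) \<partial>circ) \<longlonglongrightarrow> (\<integral>z. f z * indicator C z \<partial>circ)"
  proof (rule integral_dominated_convergence[where w = "\<lambda>z. norm (f z)"])
    show "AE z in circ. (\<lambda>n. f z * of_real (h n z)) \<longlonglongrightarrow> f z * indicator C z"
    proof (rule AE_I2)
      fix z
      have "(\<lambda>n. h n z) \<longlonglongrightarrow> indicator C z"
      proof (cases "z \<in> C")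
        case True then show ?thesis by (simp add: h_def)
      next
        case z: False
        then have d: "infdist z C > 0"
          using in_closed_iff_infdist_zero[OF C False, of z] infdist_nonneg[of z C] by simp
        obtain N where N: "real N * infdist z C \<ge> 1"
          using reals_Archimedean3[OF d] less_imp_le by blast
        have "\<forall>\<^sub>F n in sequentially. h n z = 0"
          using eventually_ge_at_top[of N]
        proof eventually_elim
          case (elim n)
          then have "real N * infdist z C \<le> real n * infdist z C"
            using d by (intro mult_right_mono) auto
          with N show ?case by (simp add: h_def)
        qed
        then show ?thesis using z by (simp add: tendsto_eventually)
      qed
      then have "(\<lambda>n. f z * of_real (h n z)) \<longlonglongrightarrow> f z * of_real (indicator C z)"
        by (intro tendsto_intros)
      then show "(\<lambda>n. f z * of_real (h n z)) \<longlonglongrightarrow> f z * indicator C z"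
        by (cases "z \<in> C") simp_all
    qed
    show "AE z in circ. norm (f z * of_real (h n z)) \<le> norm (f z)" for n
      using h01[of n] by (intro AE_I2) (auto simp: norm_mult intro: mult_left_le)
  qed (use i in auto)
  then show ?thesis
    by (simp add: annihilates_continuous[OF f cont] LIMSEQ_const_iff)
qed simp

text \<open>Closed sets are stable under intersection and generate the Borel sets, hence Dynkin's argument applies.\<close>

lemma annihilates_borel:
  assumes f: "annihilates_powers f" and B: "B \<in> sets borel"
  shows "(\<integral>z. f z * indicator B z \<partial>circ) = 0"
proof -
  have [measurable]: "f \<in> borel_measurable borel" and i: "integrable circ f"
    using f by (auto simp: annihilates_powers_def)
  have ind: "integrable circ (\<lambda>z. f z * indicator A z)" if [measurable]: "A \<in> sets borel" for A
    by (rule Bochner_Integration.integrable_bound[OF i]) (auto simp: norm_mult indicator_def)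
  have sets: "sets borel = sigma_sets UNIV (Collect closed :: complex set set)"
    by (subst borel_eq_closed) simp
  have "Int_stable (Collect closed :: complex set set)" by (auto simp: Int_stable_def)
  moreover have "(Collect closed :: complex set set) \<subseteq> Pow UNIV" by simp
  moreover have "B \<in> sigma_sets UNIV (Collect closed)" using B sets by simp
  ultimately show ?thesis
  proof (induction rule: sigma_sets_induct_disjoint)
    case (basic A) then show ?case using annihilates_closed[OF f] by simp
  next
    case empty show ?case by simp
  next
    case (compl A)
    have "(\<integral>z. f z * indicator (UNIV - A) z \<partial>circ) = (\<integral>z. f z - f z * indicator A z \<partial>circ)"
      by (intro Bochner_Integration.integral_cong) (auto simp: indicator_def)
    also have "\<dots> = 0"
      using compl annihilates_closed[OF f closed_UNIV] ind[of A] i sets by simp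
    finally show ?case .
  next
    case (union A)
    then have A [measurable]: "A n \<in> sets borel" for n using sets by auto
    have sc: "indicator S z *\<^sub>R f z = f z * indicator S z" for S z by (simp add: indicator_def)
    have "(LINT z:(\<Union>i. A i)|circ. f z) = (\<Sum>i. (LINT z:(A i)|circ. f z))"
    proof (rule lebesgue_integral_countable_add)
      show "set_integrable circ (\<Union>i. A i) f"
        unfolding set_integrable_def sc by (rule ind) simp
    qed (use union(1) in \<open>auto simp: disjoint_family_on_def\<close>)
    moreover have "(LINT z:S|circ. f z) = (\<integral>z. f z * indicator S z \<partial>circ)" for S
      unfolding set_lebesgue_integral_def sc ..
    ultimately show ?case using union(3) by simp
  qed
qed

lemma annihilates_imp_AE_0:
  assumes f: "annihilates_powers f"
  shows "AE z in circ. f z = 0"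
proof -
  have [measurable]: "f \<in> borel_measurable borel" and i: "integrable circ f"
    using f by (auto simp: annihilates_powers_def)
  have ind: "integrable circ (\<lambda>z. f z * indicator A z)" if [measurable]: "A \<in> sets borel" for A
    by (rule Bochner_Integration.integrable_bound[OF i]) (auto simp: norm_mult indicator_def)
  have "AE z in circ. Re (f z) = 0"
  proof (rule density_unique_real)
    fix A assume A: "A \<in> sets circ"
    have "(LINT z:A|circ. Re (f z)) = (\<integral>z. Re (f z * indicator A z) \<partial>circ)"
      unfolding set_lebesgue_integral_def
      by (intro Bochner_Integration.integral_cong) (auto simp: indicator_def)
    also have "\<dots> = Re (\<integral>z. f z * indicator A z \<partial>circ)"
      using ind[of A] A by (intro integral_Re) simp
    also have "\<dots> = 0" using annihilates_borel[OF f, of A] A by simp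
    finally show "(LINT z:A|circ. Re (f z)) = (LINT z:A|circ. 0)" by (simp add: set_lebesgue_integral_def)
  qed (use i in auto)
  moreover have "AE z in circ. Im (f z) = 0"
  proof (rule density_unique_real)
    fix A assume A: "A \<in> sets circ"
    have "(LINT z:A|circ. Im (f z)) = (\<integral>z. Im (f z * indicator A z) \<partial>circ)"
      unfolding set_lebesgue_integral_def
      by (intro Bochner_Integration.integral_cong) (auto simp: indicator_def)
    also have "\<dots> = Im (\<integral>z. f z * indicator A z \<partial>circ)"
      using ind[of A] A by (intro integral_Im) simp
    also have "\<dots> = 0" using annihilates_borel[OF f, of A] A by simp
    finally show "(LINT z:A|circ. Im (f z)) = (LINT z:A|circ. 0)" by (simp add: set_lebesgue_integral_def)
  qed (use i in auto)
  ultimately show ?thesis by eventually_elim (simp add: complex_eq_iff)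
qed

lemma fourier_unique:
  assumes "f \<in> L2" "\<And>n. fourier_coeff f n = 0"
  shows "f = 0"
proof -
  have "\<forall>n. fourier_coeff f n = 0" using assms(2) by simp
  with assms(1) show ?thesis unfolding L2_def mem_Collect_eq
  proof transfer
    fix f :: "complex \<Rightarrow> complex"
    assume meas: "f \<in> borel_measurable borel \<and> f \<in> borel_measurable borel \<and> (AE z in circ. f z = f z)"
    from meas have [measurable]: "f \<in> borel_measurable borel" by simp
    assume i: "integrable circ (\<lambda>z. (norm (f z))\<^sup>2)" and c: "\<forall>n. (\<integral>z. f z * cnj (z powi n) \<partial>circ) = 0"
    have "integrable circ (\<lambda>z. f z * cnj 1)" by (rule integrable_inner) (use i in simp_all)
    moreover have "(\<integral>z. f z * z powi n \<partial>circ) = 0" for n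
    proof -
      have "(\<integral>z. f z * z powi n \<partial>circ) = (\<integral>z. f z * cnj (z powi (- n)) \<partial>circ)"
        by (rule integral_cong_AE) (use AE_circ_norm in \<open>auto elim!: AE_mp simp: cnj_powi\<close>)
      then show ?thesis using c by simp
    qed
    ultimately have "annihilates_powers f" by (simp add: annihilates_powers_def)
    then have "AE z in circ. f z = 0" by (rule annihilates_imp_AE_0)
    then show "f \<in> borel_measurable borel \<and> (\<lambda>_. 0::complex) \<in> borel_measurable borel \<and> (AE z in circ. f z = 0)"
      by simp
  qed
qed

text \<open>The limit provided by Riesz-Fischer has the coefficients of \<open>f\<close>, hence equals \<open>f\<close> by uniqueness.\<close>

lemma fourier_series:
  assumes f: "f \<in> L2"
  shows "(\<lambda>N. l2_norm (trig_sum (fourier_coeff f) {- int N..int N} - f)) \<longlonglongrightarrow> 0"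
proof -
  obtain p where p: "p \<in> L2" "\<And>n. fourier_coeff p n = fourier_coeff f n"
    and lim: "(\<lambda>N. l2_norm (trig_sum (fourier_coeff f) {- int N..int N} - p)) \<longlonglongrightarrow> 0"
    using Riesz_Fischer[OF Bessel[OF f]] by fastforce
  have "p - f = 0"
    by (rule fourier_unique)
       (use p f in \<open>auto simp: L2_diff fourier_coeff_conv_inner l2_inner_diff_left zpow_L2\<close>)
  with lim show ?thesis by simp
qed

section \<open>Fourier coefficients of inner functions\<close>

text \<open>A form of Cauchy's theorem: on a smaller circle the power series converges uniformly, and none of the
  exponents that occur after multiplication by \<open>z ^ k\<close> is zero.  The indicator makes the integrand Borel on
  the whole plane.\<close>

lemma integral_holomorphic_circle:
  assumes F: "F holomorphic_on ball 0 1" and r: "0 < r" "r < 1" and k: "k > 0"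
  shows "(\<integral>z. indicator (sphere 0 1) z *\<^sub>R F (of_real r * z) * z ^ k \<partial>circ) = 0"
proof -
  define a where "a n = (deriv ^^ n) F 0 / fact n" for n
  have s: "(\<lambda>n. a n * w ^ n) sums F w" if "norm w < 1" for w
    using holomorphic_power_series[OF F, of w] that by (simp add: a_def)
  obtain R where R: "r < R" "R < 1" using dense[OF r(2)] by blast
  have "summable (\<lambda>n. norm (a n * (of_real r) ^ n))"
    by (rule powser_insidea[of _ "of_real R"]) (use s[of "of_real R"] R r in \<open>auto simp: sums_iff\<close>)
  then have sa: "summable (\<lambda>n. norm (a n) * r ^ n)" using r by (simp add: norm_mult norm_power)
  define S where "S m z = (\<Sum>n<m. a n * of_real r ^ n * z powi (int (n + k)))" for m z
  have Sm [measurable]: "S m \<in> borel_measurable borel" for m unfolding S_def by measurable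
  have Fm [measurable]: "(\<lambda>z. indicator (sphere 0 1) z *\<^sub>R F (of_real r * z)) \<in> borel_measurable borel"
  proof (rule borel_measurable_continuous_on_indicator)
    show "continuous_on (sphere 0 1) (\<lambda>z. F (of_real r * z))"
      by (rule continuous_on_compose2[OF holomorphic_on_imp_continuous_on[OF F]])
         (use r in \<open>auto intro!: continuous_intros simp: norm_mult\<close>)
  qed simp
  have "(\<lambda>m. \<integral>z. S m z \<partial>circ) \<longlonglongrightarrow> (\<integral>z. indicator (sphere 0 1) z *\<^sub>R F (of_real r * z) * z ^ k \<partial>circ)"
  proof (rule integral_dominated_convergence[where w = "\<lambda>_. \<Sum>n. norm (a n) * r ^ n"])
    show "AE z in circ. (\<lambda>m. S m z) \<longlonglongrightarrow> indicator (sphere 0 1) z *\<^sub>R F (of_real r * z) * z ^ k"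
      using AE_circ_norm
    proof eventually_elim
      case (elim z)
      have "(\<lambda>n. a n * (of_real r * z) ^ n * z ^ k) sums (F (of_real r * z) * z ^ k)"
        using s[of "of_real r * z"] r elim by (intro sums_mult2) (simp add: norm_mult)
      moreover have "a n * (of_real r * z) ^ n * z ^ k = a n * of_real r ^ n * z powi (int (n + k))" for n
        by (simp only: power_int_of_nat power_add power_mult_distrib mult.assoc)
      ultimately show ?case using elim by (simp add: S_def sums_def)
    qed
    show "AE z in circ. norm (S m z) \<le> (\<Sum>n. norm (a n) * r ^ n)" for m
      using AE_circ_norm
    proof eventually_elim
      case (elim z)
      have "norm (S m z) \<le> (\<Sum>n<m. norm (a n * of_real r ^ n * z powi (int (n + k))))"
        unfolding S_def by (rule norm_sum)
      also have "\<dots> = (\<Sum>n<m. norm (a n) * r ^ n)"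
        using elim r by (intro sum.cong) (auto simp: norm_mult norm_power norm_power_int)
      also have "\<dots> \<le> (\<Sum>n. norm (a n) * r ^ n)"
        by (rule sum_le_suminf[OF sa]) (use r in auto)
      finally show ?case .
    qed
  qed (use borel_measurable_times[OF Fm borel_measurable_power[OF measurable_ident, of k]] in \<open>auto\<close>)
  moreover have "(\<integral>z. S m z \<partial>circ) = 0" for m
  proof -
    have "integrable circ (\<lambda>z. c * z powi n)" for c :: complex and n
      using integrable_mult_powi[of "\<lambda>_. c" n] by simp
    then have "(\<integral>z. S m z \<partial>circ) = (\<Sum>n<m. \<integral>z. a n * of_real r ^ n * z powi (int (n + k)) \<partial>circ)"
      unfolding S_def by (rule Bochner_Integration.integral_sum)
    also have "\<dots> = (\<Sum>n<m. a n * of_real r ^ n * (\<integral>z. z powi (int (n + k)) \<partial>circ))"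
      by (intro sum.cong refl integral_mult_right_zero)
    also have "\<dots> = 0" unfolding integral_circ_power_int using k by simp
    finally show ?thesis .
  qed
  ultimately show ?thesis by (simp add: LIMSEQ_const_iff)
qed

text \<open>Boundary functions of bounded analytic functions lie in the Hardy space: let the radius tend to one, with
  the bound of \<open>F\<close> as dominating constant.\<close>

lemma inner_fun_fourier_neg:
  assumes "inner_fun \<theta>" "n < 0"
  shows "fourier_coeff \<theta> n = 0"
proof -
  obtain F where F: "F holomorphic_on ball 0 1" "bounded (F ` ball 0 1)" and rad: "has_radial_limits F \<theta>"
    using assms(1) by (auto simp: inner_fun_def)
  obtain B where B: "\<And>w. norm w < 1 \<Longrightarrow> norm (F w) \<le> B"
    using F(2) unfolding bounded_iff by (metis image_eqI mem_ball_0)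
  define k where "k = nat (- n)"
  have k: "k > 0" "- n = int k" using assms(2) by (auto simp: k_def)
  from rad show ?thesis
  proof (transfer fixing: F n)
    fix \<theta> :: "complex \<Rightarrow> complex"
    assume meas: "\<theta> \<in> borel_measurable borel \<and> \<theta> \<in> borel_measurable borel \<and> (AE z in circ. \<theta> z = \<theta> z)"
    from meas have [measurable]: "\<theta> \<in> borel_measurable borel" by simp
    assume lim: "AE z in circ. ((\<lambda>r. F (of_real r * z)) \<longlongrightarrow> \<theta> z) (at_left 1)"
    define r where "r j = 1 - inverse (real (Suc (Suc j)))" for j
    have r: "0 < r j" "r j < 1" for j
      by (auto simp: r_def inverse_eq_divide field_simps)
    have rlim: "r \<longlonglongrightarrow> 1"
    proof -
      have "(\<lambda>j. 1 - inverse (real (Suc (Suc j)))) \<longlonglongrightarrow> 1 - 0"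
        by (intro tendsto_intros LIMSEQ_Suc[OF LIMSEQ_inverse_real_of_nat])
      then show ?thesis by (simp add: r_def[abs_def] del: of_nat_Suc)
    qed
    have rfl: "filterlim r (at_left 1) sequentially"
      using rlim r by (auto simp: filterlim_at less_imp_neq)
    define g where "g j z = indicator (sphere 0 1) z *\<^sub>R F (of_real (r j) * z) * z ^ k" for j and z :: complex
    have [measurable]: "g j \<in> borel_measurable borel" for j
    proof -
      have [measurable]: "(\<lambda>z. indicator (sphere 0 1) z *\<^sub>R F (of_real (r j) * z)) \<in> borel_measurable borel"
      proof (rule borel_measurable_continuous_on_indicator)
        show "continuous_on (sphere 0 1) (\<lambda>z. F (of_real (r j) * z))"
          by (rule continuous_on_compose2[OF holomorphic_on_imp_continuous_on[OF F(1)]])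
             (use r[of j] in \<open>auto intro!: continuous_intros simp: norm_mult\<close>)
      qed simp
      show ?thesis unfolding g_def by measurable
    qed
    have "(\<lambda>j. \<integral>z. g j z \<partial>circ) \<longlonglongrightarrow> (\<integral>z. \<theta> z * cnj (z powi n) \<partial>circ)"
    proof (rule integral_dominated_convergence[where w = "\<lambda>_. B"])
      show "AE z in circ. (\<lambda>j. g j z) \<longlonglongrightarrow> \<theta> z * cnj (z powi n)"
        using lim AE_circ_norm
      proof eventually_elim
        case (elim z)
        have "(\<lambda>j. F (of_real (r j) * z) * z ^ k) \<longlonglongrightarrow> \<theta> z * z ^ k"
          by (intro tendsto_mult tendsto_const filterlim_compose[OF elim(1) rfl])
        moreover have "cnj (z powi n) = z ^ k" using cnj_powi[OF elim(2), of n] k by simp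
        ultimately show ?case using elim by (simp add: g_def)
      qed
      show "AE z in circ. norm (g j z) \<le> B" for j
        using AE_circ_norm
        by eventually_elim (use B r[of j] in \<open>auto simp: g_def norm_mult norm_power\<close>)
    qed auto
    moreover have "(\<integral>z. g j z \<partial>circ) = 0" for j
      unfolding g_def by (rule integral_holomorphic_circle[OF F(1) r k(1)])
    ultimately show "(\<integral>z. \<theta> z * cnj (z powi n) \<partial>circ) = 0" by (simp add: LIMSEQ_const_iff)
  qed
qed

section \<open>Bounded linear maps and adjoints\<close>

definition l2_subspace :: "circ_fun set \<Rightarrow> bool" where
  "l2_subspace M \<longleftrightarrow> M \<subseteq> L2 \<and> 0 \<in> M \<and> (\<forall>f\<in>M. \<forall>g\<in>M. f + g \<in> M) \<and> (\<forall>c. \<forall>f\<in>M. const_fun c * f \<in> M)"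

lemma l2_subspaceD:
  assumes "l2_subspace M"
  shows "f \<in> M \<Longrightarrow> f \<in> L2" "0 \<in> M" "f \<in> M \<Longrightarrow> g \<in> M \<Longrightarrow> f + g \<in> M"
    "f \<in> M \<Longrightarrow> const_fun c * f \<in> M" "f \<in> M \<Longrightarrow> g \<in> M \<Longrightarrow> f - g \<in> M"
proof -
  show *: "f \<in> M \<Longrightarrow> f \<in> L2" "0 \<in> M" "\<And>f g. f \<in> M \<Longrightarrow> g \<in> M \<Longrightarrow> f + g \<in> M"
    "\<And>f c. f \<in> M \<Longrightarrow> const_fun c * f \<in> M" using assms by (auto simp: l2_subspace_def)
  show "f - g \<in> M" if "f \<in> M" "g \<in> M"
    using *(3)[OF that(1) *(4)[OF that(2), of "-1"]] by (simp add: const_fun_simps)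
qed

lemma l2_subspace_L2: "l2_subspace L2"
  by (simp add: l2_subspace_def L2_0 L2_add L2_const)

lemma l2_subspace_H2: "l2_subspace H2"
  by (auto simp: l2_subspace_def H2_def L2_0 L2_add L2_const fourier_coeff_conv_inner l2_inner_zero l2_inner_add_left
      zpow_L2 l2_inner_const_left)

lemma l2_subspace_ominus: "l2_subspace M \<Longrightarrow> N \<subseteq> L2 \<Longrightarrow> l2_subspace (M \<ominus> N)"
  unfolding l2_subspace_def ominus_def
  by (auto simp: l2_inner_zero l2_inner_const_left subset_iff) (simp add: l2_inner_add_left subset_iff)

text \<open>Domain and codomain are separate, so that projections, multiplications and operators on a subspace can be
  composed.\<close>

definition bounded_map :: "circ_fun set \<Rightarrow> circ_fun set \<Rightarrow> (circ_fun \<Rightarrow> circ_fun) \<Rightarrow> bool" where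
  "bounded_map M N T \<longleftrightarrow> (\<forall>f\<in>M. T f \<in> N) \<and>
     (\<forall>f\<in>M. \<forall>g\<in>M. T (f + g) = T f + T g) \<and>
     (\<forall>c. \<forall>f\<in>M. T (const_fun c * f) = const_fun c * T f) \<and>
     (\<exists>C\<ge>0. \<forall>f\<in>M. l2_norm (T f) \<le> C * l2_norm f)"

lemma bounded_operator_on_eq: "bounded_operator_on M T \<longleftrightarrow> bounded_map M M T"
proof -
  have "\<exists>C\<ge>0. \<forall>f\<in>M. l2_norm (T f) \<le> C * l2_norm f" if "\<forall>f\<in>M. l2_norm (T f) \<le> C * l2_norm f" for C
  proof (intro exI[of _ "\<bar>C\<bar>"] conjI ballI)
    fix f assume "f \<in> M"
    then have "l2_norm (T f) \<le> C * l2_norm f" using that by blast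
    also have "\<dots> \<le> \<bar>C\<bar> * l2_norm f" by (intro mult_right_mono) (auto simp: l2_norm_ge_0)
    finally show "l2_norm (T f) \<le> \<bar>C\<bar> * l2_norm f" .
  qed simp
  then show ?thesis unfolding bounded_map_def bounded_operator_on_def by blast
qed

lemma bounded_map_compose:
  assumes S: "bounded_map N K S" and T: "bounded_map M N T"
  shows "bounded_map M K (\<lambda>f. S (T f))"
proof -
  obtain C where C: "C \<ge> 0" "\<And>f. f \<in> N \<Longrightarrow> l2_norm (S f) \<le> C * l2_norm f"
    using S by (auto simp: bounded_map_def)
  obtain B where B: "B \<ge> 0" "\<And>f. f \<in> M \<Longrightarrow> l2_norm (T f) \<le> B * l2_norm f"
    using T by (auto simp: bounded_map_def)
  have "l2_norm (S (T f)) \<le> (C * B) * l2_norm f" if "f \<in> M" for f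
  proof -
    have "l2_norm (S (T f)) \<le> C * l2_norm (T f)" using C(2) T that by (auto simp: bounded_map_def)
    also have "\<dots> \<le> C * (B * l2_norm f)" by (intro mult_left_mono B(2) that C(1))
    finally show ?thesis by (simp add: mult.assoc)
  qed
  then have "\<exists>C\<ge>0. \<forall>f\<in>M. l2_norm (S (T f)) \<le> C * l2_norm f"
    using B(1) C(1) by (intro exI[of _ "C * B"]) simp
  with S T show ?thesis unfolding bounded_map_def by simp
qed

lemma bounded_map_diff:
  assumes S: "bounded_map M N S" and T: "bounded_map M N T" and N: "l2_subspace N"
  shows "bounded_map M N (\<lambda>f. S f - T f)"
proof -
  obtain C where C: "C \<ge> 0" "\<And>f. f \<in> M \<Longrightarrow> l2_norm (S f) \<le> C * l2_norm f"
    using S by (auto simp: bounded_map_def)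
  obtain B where B: "B \<ge> 0" "\<And>f. f \<in> M \<Longrightarrow> l2_norm (T f) \<le> B * l2_norm f"
    using T by (auto simp: bounded_map_def)
  have "l2_norm (S f - T f) \<le> (C + B) * l2_norm f" if "f \<in> M" for f
  proof -
    have "S f \<in> L2" "T f \<in> L2" using S T that l2_subspaceD(1)[OF N] by (auto simp: bounded_map_def)
    then have "l2_norm (S f - T f) \<le> l2_norm (S f) + l2_norm (T f)"
      using l2_triangle[of "S f" "- T f"] by (simp add: L2_uminus l2_norm_uminus)
    then show ?thesis using B(2)[OF that] C(2)[OF that] by (simp add: ring_distribs)
  qed
  then have "\<exists>C\<ge>0. \<forall>f\<in>M. l2_norm (S f - T f) \<le> C * l2_norm f"
    using B(1) C(1) by (intro exI[of _ "C + B"]) simp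
  moreover have "S (f + g) - T (f + g) = (S f - T f) + (S g - T g)" if "f \<in> M" "g \<in> M" for f g
  proof -
    have "S (f + g) = S f + S g" "T (f + g) = T f + T g"
      using S T that unfolding bounded_map_def by blast+
    then show ?thesis by simp
  qed
  moreover have "S (const_fun c * f) - T (const_fun c * f) = const_fun c * (S f - T f)" if "f \<in> M" for c f
  proof -
    have "S (const_fun c * f) = const_fun c * S f" "T (const_fun c * f) = const_fun c * T f"
      using S T that unfolding bounded_map_def by blast+
    then show ?thesis by (simp add: right_diff_distrib)
  qed
  moreover have "S f - T f \<in> N" if "f \<in> M" for f
    using S T that l2_subspaceD(5)[OF N] unfolding bounded_map_def by blast
  ultimately show ?thesis unfolding bounded_map_def by blast
qed

lemma bounded_map_zero: "bounded_map M N T \<Longrightarrow> 0 \<in> M \<Longrightarrow> T 0 = 0"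
proof -
  assume T: "bounded_map M N T" and 0: "0 \<in> M"
  have "T (const_fun 0 * 0) = const_fun 0 * T 0" using T 0 unfolding bounded_map_def by blast
  then show ?thesis by (simp add: const_fun_simps)
qed

lemma bounded_map_minus:
  "bounded_map M N T \<Longrightarrow> l2_subspace M \<Longrightarrow> f \<in> M \<Longrightarrow> g \<in> M \<Longrightarrow> T (f - g) = T f - T g"
proof -
  assume T: "bounded_map M N T" and M: "l2_subspace M" and fg: "f \<in> M" "g \<in> M"
  have "T ((f - g) + g) = T (f - g) + T g"
    using T l2_subspaceD(5)[OF M fg] fg(2) unfolding bounded_map_def by blast
  then show ?thesis by simp
qed

lemma bounded_map_mult: "a \<in> Linf \<Longrightarrow> bounded_map L2 L2 (\<lambda>f. a * f)"
  using l2_norm_mult_bounded[of a] by (simp add: bounded_map_def L2_mult_Linf distrib_left mult.left_commute)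

lemma bounded_map_flip: "bounded_map L2 L2 flip"
  unfolding bounded_map_def by (auto simp: L2_flip flip_simps l2_norm_flip intro!: exI[of _ 1])

lemma bounded_map_trig_sum:
  assumes R: "bounded_map L2 L2 R" and I: "finite I"
  shows "R (trig_sum c I) = (\<Sum>n\<in>I. const_fun (c n) * R (zpow n))"
  using I
proof (induction I rule: finite_induct)
  case empty
  then show ?case using bounded_map_zero[OF R] by (simp add: trig_sum_def L2_0)
next
  case (insert n I)
  have "R (const_fun (c n) * zpow n + trig_sum c I) = const_fun (c n) * R (zpow n) + R (trig_sum c I)"
    using R by (simp add: bounded_map_def L2_const zpow_L2 trig_sum_L2)
  then show ?case using insert by (simp add: trig_sum_def)
qed

text \<open>Fourier series converge in norm, so a bounded linear map is determined by its values on the characters.\<close>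

lemma bounded_map_eq_0:
  assumes R: "bounded_map L2 L2 R" and z: "\<And>n. R (zpow n) = 0" and f: "f \<in> L2"
  shows "R f = 0"
proof -
  obtain C where C: "C \<ge> 0" "\<And>f. f \<in> L2 \<Longrightarrow> l2_norm (R f) \<le> C * l2_norm f"
    using R by (auto simp: bounded_map_def)
  define S where "S N = trig_sum (fourier_coeff f) {- int N..int N}" for N :: nat
  have RS: "R (S N) = 0" for N unfolding S_def by (subst bounded_map_trig_sum[OF R]) (auto simp: z)
  have SL: "S N \<in> L2" for N by (simp add: S_def trig_sum_L2)
  have le: "l2_norm (R f) \<le> C * l2_norm (S N - f)" for N
    using C(2)[of "S N - f"] bounded_map_minus[OF R l2_subspace_L2 SL[of N] f] RS[of N] SL[of N] f
    by (simp add: L2_diff l2_norm_uminus)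
  have "(\<lambda>N. C * l2_norm (S N - f)) \<longlonglongrightarrow> C * 0"
    unfolding S_def by (intro tendsto_intros fourier_series f)
  then have "l2_norm (R f) \<le> C * 0" by (rule LIMSEQ_le_const) (use le in auto)
  then have "l2_norm (R f) = 0" using l2_norm_ge_0[of "R f"] by simp
  moreover have "R f \<in> L2" using R f by (simp add: bounded_map_def)
  ultimately show ?thesis by (intro l2_norm_eq_0)
qed

text \<open>The coefficients of the representing vector are dictated by the characters.  They are square summable
  because testing the functional on their own partial sum \<open>s\<close> gives \<open>\<parallel>s\<parallel>\<^sup>2 \<le> C \<parallel>s\<parallel> \<parallel>g\<parallel>\<close>.\<close>

lemma Riesz_representation:
  assumes R: "bounded_map L2 L2 R" and g: "g \<in> L2"
  shows "\<exists>k\<in>L2. \<forall>f\<in>L2. l2_inner (R f) g = l2_inner f k"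
proof -
  obtain C where C: "C \<ge> 0" "\<And>f. f \<in> L2 \<Longrightarrow> l2_norm (R f) \<le> C * l2_norm f"
    using R by (auto simp: bounded_map_def)
  have RL: "R f \<in> L2" if "f \<in> L2" for f using R that by (simp add: bounded_map_def)
  define c where "c n = cnj (l2_inner (R (zpow n)) g)" for n
  have Rt: "l2_inner (R (trig_sum d I)) g = (\<Sum>n\<in>I. d n * cnj (c n))" if "finite I" for d I
    by (simp add: bounded_map_trig_sum[OF R that] l2_inner_sum_left L2_const RL zpow_L2 g l2_inner_const_left c_def)
  have bd: "(\<Sum>n\<in>I. (norm (c n))\<^sup>2) \<le> (C * l2_norm g)\<^sup>2" if I: "finite I" for I
  proof -
    define s where "s = trig_sum c I"
    have sL: "s \<in> L2" by (simp add: s_def trig_sum_L2)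
    have "l2_inner (R s) g = (\<Sum>n\<in>I. c n * cnj (c n))" unfolding s_def by (rule Rt[OF I])
    also have "\<dots> = of_real ((l2_norm s)\<^sup>2)"
      unfolding s_def l2_norm_trig_sum[OF I] of_real_sum complex_norm_square ..
    finally have "l2_inner (R s) g = of_real ((l2_norm s)\<^sup>2)" .
    then have "(l2_norm s)\<^sup>2 = norm (l2_inner (R s) g)" by (simp add: norm_power)
    also have "\<dots> \<le> l2_norm (R s) * l2_norm g" by (rule l2_Cauchy_Schwarz[OF RL[OF sL] g])
    also have "\<dots> \<le> C * l2_norm s * l2_norm g" by (intro mult_right_mono C(2) sL l2_norm_ge_0)
    finally have "l2_norm s * l2_norm s \<le> l2_norm s * (C * l2_norm g)" by (simp add: power2_eq_square mult_ac)
    then have "l2_norm s \<le> C * l2_norm g"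
      using l2_norm_ge_0[of s] l2_norm_ge_0[of g] C(1) by (cases "l2_norm s = 0") (auto simp: mult_le_cancel_left)
    then have "(l2_norm s)\<^sup>2 \<le> (C * l2_norm g)\<^sup>2" by (intro power_mono l2_norm_ge_0)
    then show ?thesis by (simp add: s_def l2_norm_trig_sum[OF I])
  qed
  obtain k where k: "k \<in> L2" "\<And>n. fourier_coeff k n = c n"
    using Riesz_Fischer[of c, OF bd] by auto
  have "l2_inner (R f) g = l2_inner f k" if f: "f \<in> L2" for f
  proof -
    define S where "S N = trig_sum (fourier_coeff f) {- int N..int N}" for N :: nat
    have SL: "S N \<in> L2" for N by (simp add: S_def trig_sum_L2)
    have lim: "(\<lambda>N. l2_norm (S N - f)) \<longlonglongrightarrow> 0" unfolding S_def by (rule fourier_series[OF f])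
    have "(\<lambda>N. l2_norm (R (S N) - R f)) \<longlonglongrightarrow> 0"
    proof (rule Lim_null_comparison)
      show "\<forall>\<^sub>F N in sequentially. norm (l2_norm (R (S N) - R f)) \<le> C * l2_norm (S N - f)"
        using C(2)[of "S _ - f"] bounded_map_minus[OF R l2_subspace_L2 SL f] SL f
        by (intro always_eventually) (auto simp: L2_diff l2_norm_ge_0)
      show "(\<lambda>N. C * l2_norm (S N - f)) \<longlonglongrightarrow> 0" using tendsto_mult_right_zero[OF lim] .
    qed
    then have "(\<lambda>N. l2_inner (R (S N)) g) \<longlonglongrightarrow> l2_inner (R f) g"
      by (intro tendsto_l2_inner RL SL f g)
    moreover have "l2_inner (R (S N)) g = l2_inner (S N) k" for N
      unfolding S_def by (simp add: Rt l2_inner_trig_sum_left k)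
    moreover have "(\<lambda>N. l2_inner (S N) k) \<longlonglongrightarrow> l2_inner f k"
      by (intro tendsto_l2_inner SL f k(1) lim)
    ultimately show ?thesis by (simp add: LIMSEQ_unique)
  qed
  with k(1) show ?thesis by blast
qed

text \<open>Uniqueness, which is what the definite description in the definition of the adjoint requires.\<close>

lemma adjoint_on_eq:
  assumes M: "l2_subspace M" and k: "k \<in> M" and "\<And>f. f \<in> M \<Longrightarrow> l2_inner (T f) g = l2_inner f k"
  shows "adjoint_on M T g = k"
  unfolding adjoint_on_def
proof (rule the_equality)
  show "k \<in> M \<and> (\<forall>f\<in>M. l2_inner (T f) g = l2_inner f k)" using assms by blast
  fix k' assume k': "k' \<in> M \<and> (\<forall>f\<in>M. l2_inner (T f) g = l2_inner f k')"
  then have d: "k' - k \<in> M" using k l2_subspaceD(5)[OF M] by blast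
  have "l2_inner (k' - k) (k' - k) = l2_inner (k' - k) k' - l2_inner (k' - k) k"
    using l2_subspaceD(1)[OF M] d k k' by (intro l2_inner_diff_right) auto
  also have "\<dots> = 0" using assms(3)[OF d] k' d by auto
  finally have "k' - k = 0" using l2_inner_self_eq_0 l2_subspaceD(1)[OF M d] by blast
  then show "k' = k" by simp
qed

section \<open>The Riesz projection\<close>

text \<open>The hypothesis says that \<open>p\<close> is an orthogonal component of \<open>f\<close>.\<close>

lemma norm_le_if_inner_eq:
  assumes "f \<in> L2" "p \<in> L2" "l2_inner f p = l2_inner p p"
  shows "l2_norm p \<le> l2_norm f"
proof -
  have "l2_norm p * l2_norm p = norm (l2_inner f p)"
    by (simp add: assms(3) l2_inner_self_norm norm_power power2_eq_square[symmetric])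
  also have "\<dots> \<le> l2_norm f * l2_norm p" by (rule l2_Cauchy_Schwarz[OF assms(1,2)])
  finally show ?thesis
    using l2_norm_ge_0[of p] l2_norm_ge_0[of f] by (cases "l2_norm p = 0") (auto simp: mult_le_cancel_right)
qed

text \<open>The space of square integrable functions with negative frequencies only, i.e. the orthogonal complement
  of \<open>H2\<close>.\<close>

definition coH2 :: "circ_fun set" where
  "coH2 = {f \<in> L2. \<forall>n\<ge>0. fourier_coeff f n = 0}"

lemma H2_L2: "f \<in> H2 \<Longrightarrow> f \<in> L2" and coH2_L2: "f \<in> coH2 \<Longrightarrow> f \<in> L2"
  by (simp_all add: H2_def coH2_def)

lemma fourier_coeff_zpow_mult: "fourier_coeff (zpow m * f) n = fourier_coeff f (n - m)"
  unfolding fourier_coeff_conv_inner l2_inner_mult conj_zpow by (simp flip: zpow_add)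

lemma fourier_coeff_simps:
  "f \<in> L2 \<Longrightarrow> g \<in> L2 \<Longrightarrow> fourier_coeff (f + g) n = fourier_coeff f n + fourier_coeff g n"
  "f \<in> L2 \<Longrightarrow> g \<in> L2 \<Longrightarrow> fourier_coeff (f - g) n = fourier_coeff f n - fourier_coeff g n"
  "fourier_coeff (const_fun c * f) n = c * fourier_coeff f n"
  by (simp_all add: fourier_coeff_conv_inner l2_inner_add_left l2_inner_diff_left l2_inner_const_left zpow_L2)

lemma fourier_coeff_zpow: "fourier_coeff (zpow m) n = (if m = n then 1 else 0)"
  by (simp add: fourier_coeff_conv_inner l2_inner_zpow)

lemma zpow_H2: "n \<ge> 0 \<Longrightarrow> zpow n \<in> H2" and zpow_coH2: "n < 0 \<Longrightarrow> zpow n \<in> coH2"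
  by (auto simp: H2_def coH2_def zpow_L2 fourier_coeff_zpow)

lemma one_H2: "1 \<in> H2" using zpow_H2[of 0] by (simp add: zpow_0)

lemma zpow_mult_H2: "n \<ge> 0 \<Longrightarrow> f \<in> H2 \<Longrightarrow> zpow n * f \<in> H2"
  by (simp add: H2_def L2_zpow fourier_coeff_zpow_mult)

lemma H2_coH2_orth:
  assumes g: "g \<in> H2" and h: "h \<in> coH2"
  shows "l2_inner g h = 0"
proof -
  have gL: "g \<in> L2" and hL: "h \<in> L2" using assms H2_L2 coH2_L2 by auto
  have "(\<lambda>N. l2_inner (trig_sum (fourier_coeff g) {- int N..int N}) h) \<longlonglongrightarrow> l2_inner g h"
    by (intro tendsto_l2_inner trig_sum_L2 gL hL fourier_series)
  moreover have "l2_inner (trig_sum (fourier_coeff g) {- int N..int N}) h = 0" for N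
    unfolding l2_inner_trig_sum_left[OF hL]
  proof (rule sum.neutral, rule ballI)
    fix n show "fourier_coeff g n * cnj (fourier_coeff h n) = 0"
      using g h by (cases "n < 0") (auto simp: H2_def coH2_def)
  qed
  ultimately show ?thesis by (simp add: LIMSEQ_const_iff)
qed

lemma coH2_H2_orth: "h \<in> coH2 \<Longrightarrow> g \<in> H2 \<Longrightarrow> l2_inner h g = 0"
  using H2_coH2_orth[of g h] by (subst l2_inner_cnj) simp

lemma l2_subspace_coH2: "l2_subspace coH2"
  by (auto simp: l2_subspace_def coH2_def L2_0 L2_add L2_const fourier_coeff_simps)
     (simp add: fourier_coeff_conv_inner l2_inner_zero)

lemma proj_H2_eq:
  assumes f: "f \<in> L2" and p: "p \<in> H2" and q: "f - p \<in> coH2"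
  shows "proj_H2 f = p"
  unfolding proj_H2_def orth_proj_def
proof (rule the_equality)
  show "p \<in> H2 \<and> (\<forall>g\<in>H2. l2_inner (f - p) g = 0)" using p q coH2_H2_orth by blast
  fix p' assume p': "p' \<in> H2 \<and> (\<forall>g\<in>H2. l2_inner (f - p') g = 0)"
  then have d: "p' - p \<in> H2" using p l2_subspaceD(5)[OF l2_subspace_H2] by blast
  have L: "f - p \<in> L2" "f - p' \<in> L2" using f p p' by (auto intro: L2_diff H2_L2)
  have "l2_inner (p' - p) (p' - p) = l2_inner ((f - p) - (f - p')) (p' - p)" by simp
  also have "\<dots> = l2_inner (f - p) (p' - p) - l2_inner (f - p') (p' - p)"
    by (intro l2_inner_diff_left L H2_L2 d)
  also have "\<dots> = 0" using p' d coH2_H2_orth[OF q d] by simp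
  finally have "p' - p = 0" using l2_inner_self_eq_0 H2_L2[OF d] by blast
  then show "p' = p" by simp
qed

text \<open>Truncating the coefficients keeps them square summable.\<close>

lemma proj_H2_ex:
  assumes f: "f \<in> L2"
  shows "\<exists>p\<in>H2. f - p \<in> coH2"
proof -
  define c where "c n = (if n < 0 then 0 else fourier_coeff f n)" for n
  have "(\<Sum>n\<in>{- int N..int N}. (norm (c n))\<^sup>2) \<le> (l2_norm f)\<^sup>2" for N
  proof -
    have "(\<Sum>n\<in>{- int N..int N}. (norm (c n))\<^sup>2) \<le> (\<Sum>n\<in>{- int N..int N}. (norm (fourier_coeff f n))\<^sup>2)"
      by (intro sum_mono) (simp add: c_def)
    also have "\<dots> \<le> (l2_norm f)\<^sup>2" by (intro Bessel f) simp
    finally show ?thesis .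
  qed
  then obtain p where p: "p \<in> L2" "\<And>n. fourier_coeff p n = c n" using Riesz_Fischer[of c] by blast
  then have "p \<in> H2" "f - p \<in> coH2"
    using f by (auto simp: H2_def coH2_def fourier_coeff_simps L2_diff c_def)
  then show ?thesis by blast
qed

lemma proj_H2: "f \<in> L2 \<Longrightarrow> proj_H2 f \<in> H2" "f \<in> L2 \<Longrightarrow> f - proj_H2 f \<in> coH2"
  using proj_H2_ex[of f] proj_H2_eq[of f] by auto

lemma proj_H2_id: "f \<in> H2 \<Longrightarrow> proj_H2 f = f"
  by (rule proj_H2_eq) (auto simp: H2_L2 l2_subspaceD[OF l2_subspace_coH2])

lemma proj_H2_coH2: "f \<in> coH2 \<Longrightarrow> proj_H2 f = 0"
  by (rule proj_H2_eq) (auto simp: coH2_L2 l2_subspaceD[OF l2_subspace_H2])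

lemma bounded_map_proj_H2: "bounded_map L2 H2 proj_H2"
  unfolding bounded_map_def
proof (intro conjI ballI allI)
  fix f g assume f: "f \<in> L2" and g: "g \<in> L2"
  have "(f - proj_H2 f) + (g - proj_H2 g) \<in> coH2"
    using f g by (intro l2_subspaceD(3)[OF l2_subspace_coH2] proj_H2)
  then show "proj_H2 (f + g) = proj_H2 f + proj_H2 g"
    by (intro proj_H2_eq L2_add f g l2_subspaceD(3)[OF l2_subspace_H2] proj_H2) (simp add: algebra_simps)
next
  fix c f assume f: "f \<in> L2"
  have "const_fun c * (f - proj_H2 f) \<in> coH2"
    using f by (intro l2_subspaceD(4)[OF l2_subspace_coH2] proj_H2)
  then show "proj_H2 (const_fun c * f) = const_fun c * proj_H2 f"
    by (intro proj_H2_eq L2_const f l2_subspaceD(4)[OF l2_subspace_H2] proj_H2) (simp add: algebra_simps)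
next
  show "\<exists>C\<ge>0. \<forall>f\<in>L2. l2_norm (proj_H2 f) \<le> C * l2_norm f"
  proof (intro exI[of _ 1] conjI ballI)
    fix f assume f: "f \<in> L2"
    have p: "proj_H2 f \<in> L2" by (rule H2_L2[OF proj_H2(1)[OF f]])
    have "l2_inner (f - proj_H2 f) (proj_H2 f) = 0" by (intro coH2_H2_orth proj_H2(1) proj_H2(2) f)
    then have "l2_inner f (proj_H2 f) = l2_inner (proj_H2 f) (proj_H2 f)"
      by (simp add: l2_inner_diff_left f p)
    then show "l2_norm (proj_H2 f) \<le> 1 * l2_norm f" using norm_le_if_inner_eq[OF f p] by simp
  qed simp
qed (rule proj_H2(1))

section \<open>The projection onto the complement of the model space\<close>

locale inner_function =
  fixes \<theta> :: circ_fun
  assumes inner: "inner_fun \<theta>"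
begin

abbreviation "K \<equiv> model_space \<theta>"
abbreviation "M \<equiv> model_perp \<theta>"
abbreviation "T \<equiv> Q_theta \<theta>"
abbreviation "\<theta>0 \<equiv> fourier_coeff \<theta> 0"

lemma unimodular_\<theta>: "unimodular \<theta>" using inner by (simp add: inner_fun_def)
lemma \<theta>_Linf: "\<theta> \<in> Linf" using unimodular_\<theta> by (rule unimodular_Linf)
lemma conj_\<theta>_Linf: "conj_fun \<theta> \<in> Linf" using \<theta>_Linf by (rule Linf_conj)
lemma conj_\<theta>_mult: "conj_fun \<theta> * (\<theta> * f) = f"
  using unimodular_conj[OF unimodular_\<theta>] by (simp flip: mult.assoc)
lemma \<theta>_conj_mult: "\<theta> * (conj_fun \<theta> * f) = f"
  using conj_\<theta>_mult[of f] by (simp add: mult.left_commute)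
lemma \<theta>_L2: "f \<in> L2 \<Longrightarrow> \<theta> * f \<in> L2" by (rule L2_mult_Linf[OF \<theta>_Linf])
lemma conj_\<theta>_L2: "f \<in> L2 \<Longrightarrow> conj_fun \<theta> * f \<in> L2" by (rule L2_mult_Linf[OF conj_\<theta>_Linf])

text \<open>By adjunction, the coefficient of \<open>\<theta> g\<close> at \<open>n < 0\<close> is the inner product of \<open>g\<close> with
  \<open>conj_fun \<theta> * zpow n\<close>, which has negative frequencies only.\<close>

lemma \<theta>_mult_H2:
  assumes g: "g \<in> H2"
  shows "\<theta> * g \<in> H2"
proof -
  have "fourier_coeff (\<theta> * g) n = 0" if n: "n < 0" for n
  proof -
    have "fourier_coeff (conj_fun \<theta> * zpow n) m = 0" if m: "m \<ge> 0" for m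
    proof -
      have "fourier_coeff (conj_fun \<theta> * zpow n) m = l2_inner (zpow n) (\<theta> * zpow m)"
        by (simp add: fourier_coeff_conv_inner l2_inner_mult conj_fun_simps)
      also have "\<dots> = cnj (fourier_coeff (zpow m * \<theta>) n)"
        by (simp add: fourier_coeff_conv_inner mult.commute flip: l2_inner_cnj)
      also have "\<dots> = 0" using n m inner_fun_fourier_neg[OF inner, of "n - m"] by (simp add: fourier_coeff_zpow_mult)
      finally show ?thesis .
    qed
    then have "conj_fun \<theta> * zpow n \<in> coH2" by (simp add: coH2_def conj_\<theta>_L2 zpow_L2)
    then show ?thesis
      using H2_coH2_orth[OF g] by (simp add: fourier_coeff_conv_inner l2_inner_mult)
  qed
  then show ?thesis using \<theta>_L2 H2_L2[OF g] by (simp add: H2_def)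
qed

lemma K_iff: "f \<in> K \<longleftrightarrow> f \<in> H2 \<and> (\<forall>g\<in>H2. l2_inner f (\<theta> * g) = 0)"
  by (auto simp: model_space_def ominus_def)

lemma K_L2: "f \<in> K \<Longrightarrow> f \<in> L2" by (simp add: K_iff H2_L2)

lemma M_iff: "f \<in> M \<longleftrightarrow> f \<in> L2 \<and> (\<forall>k\<in>K. l2_inner f k = 0)"
  by (auto simp: model_perp_def ominus_def)

lemma l2_subspace_K: "l2_subspace K"
  unfolding model_space_def by (rule l2_subspace_ominus[OF l2_subspace_H2]) (auto intro: \<theta>_L2 H2_L2)

lemma l2_subspace_M: "l2_subspace M"
  unfolding model_perp_def by (rule l2_subspace_ominus[OF l2_subspace_L2]) (auto intro: K_L2)

lemmas K_closed = l2_subspaceD[OF l2_subspace_K]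
lemmas M_closed = l2_subspaceD[OF l2_subspace_M]

lemma coH2_M: "f \<in> coH2 \<Longrightarrow> f \<in> M"
  by (simp add: M_iff K_iff coH2_L2 coH2_H2_orth)

lemma \<theta>_H2_M:
  assumes g: "g \<in> H2"
  shows "\<theta> * g \<in> M"
  unfolding M_iff
proof (intro conjI ballI)
  fix k assume "k \<in> K"
  then have "l2_inner k (\<theta> * g) = 0" using g by (simp add: K_iff)
  then show "l2_inner (\<theta> * g) k = 0" by (subst l2_inner_cnj) simp
qed (rule \<theta>_L2[OF H2_L2[OF g]])

lemma \<theta>_M: "\<theta> \<in> M" using \<theta>_H2_M[OF one_H2] by simp

lemma K_M_0: "f \<in> K \<Longrightarrow> f \<in> M \<Longrightarrow> f = 0"
  using l2_inner_self_eq_0 by (auto simp: M_iff)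

lemma T_M: assumes f: "f \<in> L2" shows "T f \<in> M"
  unfolding Q_theta_def coproj_H2_def
  by (rule M_closed(3)[OF coH2_M[OF proj_H2(2)[OF f]] \<theta>_H2_M[OF proj_H2(1)[OF conj_\<theta>_L2[OF f]]]])

text \<open>Together with \<open>T f \<in> M\<close> this says that \<open>T\<close> is the orthogonal projection onto \<open>M\<close>.  Orthogonality to
  \<open>\<theta> H2\<close> holds because \<open>f\<close> and \<open>proj_H2 f\<close> have the same inner products with that subspace of \<open>H2\<close>,
  and the isometry \<open>\<theta>\<close> carries \<open>proj_H2 (conj_fun \<theta> * f)\<close> to the component of \<open>f\<close> in it.\<close>

lemma T_K: assumes f: "f \<in> L2" shows "f - T f \<in> K"
proof -
  define p where "p = proj_H2 f"
  define q where "q = proj_H2 (conj_fun \<theta> * f)"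
  have p: "p \<in> H2" "f - p \<in> coH2" using proj_H2[OF f] by (auto simp: p_def)
  have q: "q \<in> H2" "conj_fun \<theta> * f - q \<in> coH2" using proj_H2[OF conj_\<theta>_L2[OF f]] by (auto simp: q_def)
  note L = H2_L2[OF p(1)] H2_L2[OF q(1)] \<theta>_L2 conj_\<theta>_L2 f
  have eq: "f - T f = p - \<theta> * q" by (simp add: Q_theta_def coproj_H2_def p_def q_def)
  have "l2_inner (p - \<theta> * q) (\<theta> * g) = 0" if g: "g \<in> H2" for g
  proof -
    have tg: "\<theta> * g \<in> H2" by (rule \<theta>_mult_H2[OF g])
    have "l2_inner (p - \<theta> * q) (\<theta> * g) = l2_inner (f - \<theta> * q) (\<theta> * g) - l2_inner (f - p) (\<theta> * g)"
      using L H2_L2[OF tg] by (simp add: l2_inner_diff_left L2_diff)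
    also have "l2_inner (f - p) (\<theta> * g) = 0" by (rule coH2_H2_orth[OF p(2) tg])
    also have "f - \<theta> * q = \<theta> * (conj_fun \<theta> * f - q)" by (simp add: right_diff_distrib \<theta>_conj_mult)
    also have "l2_inner \<dots> (\<theta> * g) = l2_inner (conj_fun \<theta> * f - q) g"
      by (subst l2_inner_mult) (simp add: conj_\<theta>_mult)
    also have "\<dots> = 0" by (rule coH2_H2_orth[OF q(2) g])
    finally show ?thesis by simp
  qed
  then show ?thesis unfolding eq K_iff
    using l2_subspaceD(5)[OF l2_subspace_H2 p(1) \<theta>_mult_H2[OF q(1)]] by blast
qed

text \<open>The form in which \<open>T\<close> is computed below: exhibit a decomposition along \<open>M\<close> and \<open>K\<close>.\<close>

lemma T_eq:
  assumes f: "f \<in> L2" and m: "m \<in> M" and k: "f - m \<in> K"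
  shows "T f = m"
proof -
  have "T f - m = (f - m) - (f - T f)" by simp
  then have "T f - m \<in> K" using K_closed(5)[OF k T_K[OF f]] by simp
  moreover have "T f - m \<in> M" by (intro M_closed(5) T_M f m)
  ultimately have "T f - m = 0" by (rule K_M_0)
  then show ?thesis by simp
qed

lemma T_id: "f \<in> M \<Longrightarrow> T f = f" by (rule T_eq) (auto simp: M_closed K_closed)
lemma T_0: "f \<in> K \<Longrightarrow> T f = 0" by (rule T_eq) (auto simp: M_closed K_closed)

lemma T_inner: "f \<in> L2 \<Longrightarrow> g \<in> M \<Longrightarrow> l2_inner (T f) g = l2_inner f g"
proof -
  assume f: "f \<in> L2" and g: "g \<in> M"
  have "l2_inner (f - T f) g = 0"
    using g T_K[OF f] by (subst l2_inner_cnj) (simp add: M_iff)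
  then show ?thesis using f g T_M[OF f] by (simp add: l2_inner_diff_left M_closed)
qed

lemma T_inner': "f \<in> L2 \<Longrightarrow> g \<in> M \<Longrightarrow> l2_inner g (T f) = l2_inner g f"
  using T_inner[of f g] by (simp add: l2_inner_cnj[of g])

lemma bounded_map_T: "bounded_map L2 M T"
  unfolding bounded_map_def
proof (intro conjI ballI allI)
  fix f g assume f: "f \<in> L2" and g: "g \<in> L2"
  have "(f - T f) + (g - T g) \<in> K"
    using f g by (intro K_closed(3) T_K)
  then show "T (f + g) = T f + T g"
    by (intro T_eq L2_add f g M_closed(3) T_M) (simp add: algebra_simps)
next
  fix c f assume f: "f \<in> L2"
  have "const_fun c * (f - T f) \<in> K"
    using f by (intro K_closed(4) T_K)
  then show "T (const_fun c * f) = const_fun c * T f"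
    by (intro T_eq L2_const f M_closed(4) T_M) (simp add: algebra_simps)
next
  show "\<exists>C\<ge>0. \<forall>f\<in>L2. l2_norm (T f) \<le> C * l2_norm f"
  proof (intro exI[of _ 1] conjI ballI)
    fix f assume f: "f \<in> L2"
    have p: "T f \<in> M" using f by (rule T_M)
    show "l2_norm (T f) \<le> 1 * l2_norm f"
      using norm_le_if_inner_eq[OF f M_closed(1)[OF p] T_inner[OF f p, symmetric]] by simp
  qed simp
qed (rule T_M)

lemma T_diff: "f \<in> L2 \<Longrightarrow> g \<in> L2 \<Longrightarrow> T (f - g) = T f - T g"
  by (rule bounded_map_minus[OF bounded_map_T l2_subspace_L2])
lemma T_const: "f \<in> L2 \<Longrightarrow> T (const_fun c * f) = const_fun c * T f"
  using bounded_map_T by (simp add: bounded_map_def)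

text \<open>Only the constant term of the conjugate of \<open>\<theta>\<close> survives the Riesz projection.\<close>

lemma T_one: "T 1 = const_fun (cnj \<theta>0) * \<theta>"
proof -
  have "proj_H2 (conj_fun \<theta> * 1) = const_fun (cnj \<theta>0) * 1"
  proof (rule proj_H2_eq)
    show "const_fun (cnj \<theta>0) * 1 \<in> H2" by (rule l2_subspaceD(4)[OF l2_subspace_H2 one_H2])
    have 1: "fourier_coeff (conj_fun \<theta> * 1) n = cnj (fourier_coeff \<theta> (- n))" for n
    proof -
      have "fourier_coeff (conj_fun \<theta> * 1) n = l2_inner 1 (\<theta> * zpow n)"
        by (simp only: fourier_coeff_conv_inner l2_inner_mult conj_fun_simps)
      also have "\<dots> = cnj (l2_inner (zpow n * \<theta>) 1)"
        by (subst l2_inner_cnj) (simp only: mult.commute)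
      also have "l2_inner (zpow n * \<theta>) 1 = fourier_coeff \<theta> (- n)"
        by (subst l2_inner_mult) (simp add: fourier_coeff_conv_inner conj_zpow)
      finally show ?thesis .
    qed
    have 2: "fourier_coeff 1 n = (if n = 0 then 1 else 0)" for n
      using fourier_coeff_zpow[of 0 n] by (simp add: zpow_0)
    have L: "conj_fun \<theta> * 1 \<in> L2" "const_fun (cnj \<theta>0) * 1 \<in> L2"
      by (intro conj_\<theta>_L2 L2_const L2_one)+
    have "fourier_coeff (conj_fun \<theta> * 1 - const_fun (cnj \<theta>0) * 1) n = 0" if "n \<ge> 0" for n
      unfolding fourier_coeff_simps(2)[OF L] fourier_coeff_simps(3) 1 2
      using inner_fun_fourier_neg[OF inner, of "- n"] that by auto
    then show "conj_fun \<theta> * 1 - const_fun (cnj \<theta>0) * 1 \<in> coH2"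
      unfolding coH2_def mem_Collect_eq using L2_diff[OF L] by blast
  qed (intro conj_\<theta>_L2 L2_one)
  then show ?thesis by (simp add: Q_theta_def coproj_H2_def proj_H2_id[OF one_H2] mult.commute)
qed

text \<open>The model space is invariant under the backward shift \<open>k \<mapsto> zpow (-1) * (k - k(0))\<close>, where \<open>k(0)\<close> is the
  constant coefficient; hence only the term \<open>k(0) zpow (-1)\<close> is left in \<open>M\<close>.\<close>

lemma T_conj_z_K:
  assumes k: "k \<in> K"
  shows "T (zpow (-1) * k) = const_fun (l2_inner k 1) * zpow (-1)"
proof (rule T_eq)
  have kH: "k \<in> H2" and k0: "\<And>g. g \<in> H2 \<Longrightarrow> l2_inner k (\<theta> * g) = 0" using k by (auto simp: K_iff)
  define c where "c = l2_inner k 1"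
  have c: "c = fourier_coeff k 0" by (simp add: c_def fourier_coeff_conv_inner zpow_0)
  show "zpow (-1) * k \<in> L2" by (intro L2_zpow H2_L2 kH)
  show "const_fun (l2_inner k 1) * zpow (-1) \<in> M" by (intro M_closed(4) coH2_M zpow_coH2) simp
  have "zpow (-1) * k - const_fun c * zpow (-1) \<in> H2"
  proof -
    have "fourier_coeff k (n + 1) = 0" if "n < 0" "n \<noteq> -1" for n using kH that by (auto simp: H2_def)
    then show ?thesis
      using H2_L2[OF kH]
      by (auto simp: H2_def fourier_coeff_simps L2_diff L2_zpow L2_const zpow_L2 fourier_coeff_zpow_mult
          fourier_coeff_zpow c)
  qed
  moreover have "l2_inner (zpow (-1) * k - const_fun c * zpow (-1)) (\<theta> * g) = 0" if g: "g \<in> H2" for g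
  proof -
    have "l2_inner (zpow (-1) * k) (\<theta> * g) = l2_inner k (\<theta> * (zpow 1 * g))"
      by (subst l2_inner_mult) (simp add: conj_zpow mult.left_commute)
    also have "\<dots> = 0" by (intro k0 zpow_mult_H2 g) simp
    finally have 1: "l2_inner (zpow (-1) * k) (\<theta> * g) = 0" .
    have 2: "l2_inner (zpow (-1)) (\<theta> * g) = 0"
      by (intro coH2_H2_orth zpow_coH2 \<theta>_mult_H2 g) simp
    have "\<theta> * g \<in> L2" by (intro H2_L2 \<theta>_mult_H2 g)
    then show ?thesis using 1 2 H2_L2[OF kH]
      by (simp add: l2_inner_diff_left L2_zpow L2_const zpow_L2 l2_inner_const_left)
  qed
  ultimately show "zpow (-1) * k - const_fun (l2_inner k 1) * zpow (-1) \<in> K"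
    unfolding K_iff c_def by blast
qed

text \<open>The dual statement of the preceding one: tested against \<open>k \<in> K\<close>, the vectors \<open>zpow 1 * h\<close> and \<open>c * 1\<close>
  agree for \<open>c = \<langle>h, zpow (-1)\<rangle>\<close>.  So the part of \<open>zpow 1 * h\<close> lost by the compression is a multiple of
  the projection of \<open>1\<close> onto \<open>K\<close>.\<close>

lemma M_shift:
  assumes h: "h \<in> M"
  shows "zpow 1 * h - T (zpow 1 * h) = const_fun (l2_inner h (zpow (-1))) * (1 - const_fun (cnj \<theta>0) * \<theta>)"
proof -
  define c where "c = l2_inner h (zpow (-1))"
  have hL: "h \<in> L2" using h by (rule M_closed)
  have zh: "zpow 1 * h \<in> L2" by (rule L2_zpow[OF hL])
  have c1: "const_fun c * 1 \<in> L2" by (rule L2_const[OF L2_one])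
  have "zpow 1 * h - const_fun c * 1 \<in> M"
    unfolding M_iff
  proof (intro conjI ballI L2_diff zh c1)
    fix k assume k: "k \<in> K"
    have kL: "k \<in> L2" by (rule K_L2[OF k])
    have "l2_inner (zpow 1 * h) k = l2_inner h (zpow (-1) * k)" by (simp add: l2_inner_mult conj_zpow)
    also have "\<dots> = l2_inner h (T (zpow (-1) * k))" by (rule T_inner'[OF L2_zpow[OF kL] h, symmetric])
    also have "\<dots> = c * cnj (l2_inner k 1)" by (simp add: T_conj_z_K[OF k] l2_inner_const_right c_def)
    also have "\<dots> = l2_inner (const_fun c * 1) k" by (simp only: l2_inner_const_left l2_inner_cnj[of 1 k])
    finally show "l2_inner (zpow 1 * h - const_fun c * 1) k = 0"
      by (simp only: l2_inner_diff_left zh c1 kL diff_self)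
  qed
  then have "T (zpow 1 * h - const_fun c * 1) = zpow 1 * h - const_fun c * 1" by (rule T_id)
  moreover have "T (zpow 1 * h - const_fun c * 1) = T (zpow 1 * h) - const_fun c * (const_fun (cnj \<theta>0) * \<theta>)"
    by (simp only: T_diff zh c1 T_const L2_one T_one)
  ultimately have "zpow 1 * h - const_fun c * 1 = T (zpow 1 * h) - const_fun c * (const_fun (cnj \<theta>0) * \<theta>)"
    by simp
  then show ?thesis unfolding c_def[symmetric] by (simp add: algebra_simps)
qed

lemma adjoint_shift: "g \<in> M \<Longrightarrow> adjoint_on M (compressed_shift \<theta>) g = T (zpow (-1) * g)"
  by (rule adjoint_on_eq[OF l2_subspace_M])
     (auto simp: T_M L2_zpow M_closed compressed_shift_def T_inner T_inner' l2_inner_mult conj_zpow simp flip: zpow_1)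

text \<open>Existence of the adjoint of an operator on \<open>M\<close>: extend by zero on \<open>K\<close>, represent, and project back.\<close>

lemma adjoint_on_spec:
  assumes S: "bounded_operator_on M S" and g: "g \<in> M"
  shows "adjoint_on M S g \<in> M" "\<And>f. f \<in> M \<Longrightarrow> l2_inner (S f) g = l2_inner f (adjoint_on M S g)"
proof -
  have SM: "bounded_map M M S" using S by (simp add: bounded_operator_on_eq)
  have "bounded_map L2 M (\<lambda>f. S (T f))" by (rule bounded_map_compose[OF SM bounded_map_T])
  then have "bounded_map L2 L2 (\<lambda>f. S (T f))" using M_closed(1) by (auto simp: bounded_map_def)
  then obtain k where k: "k \<in> L2" "\<And>f. f \<in> L2 \<Longrightarrow> l2_inner (S (T f)) g = l2_inner f k"
    using Riesz_representation[of _ g] M_closed(1)[OF g] by blast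
  have *: "l2_inner (S f) g = l2_inner f (T k)" if f: "f \<in> M" for f
    using k(2)[OF M_closed(1)[OF f]] by (simp add: T_id f T_inner' k(1))
  have "adjoint_on M S g = T k" by (rule adjoint_on_eq[OF l2_subspace_M T_M[OF k(1)] *])
  with * T_M[OF k(1)] show "adjoint_on M S g \<in> M" "\<And>f. f \<in> M \<Longrightarrow> l2_inner (S f) g = l2_inner f (adjoint_on M S g)"
    by simp_all
qed

section \<open>The operator identity for dual truncated Hankel operators\<close>

lemma dual_hankel_bounded:
  assumes \<phi>: "\<phi> \<in> Linf"
  shows "bounded_map L2 M (dual_hankel \<theta> \<phi>)"
proof -
  have "bounded_map L2 M (\<lambda>h. T (flip (\<phi> * h)))"
    by (rule bounded_map_compose[OF bounded_map_T bounded_map_compose[OF bounded_map_flip bounded_map_mult[OF \<phi>]]])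
  then show ?thesis by (simp add: dual_hankel_def[abs_def])
qed

text \<open>Before compression, the flip turns multiplication by \<open>z\<close> into multiplication by its conjugate, so the
  uncompressed operator intertwines the two shifts exactly.  Each compression contributes one rank one
  error: the first one the part of \<open>zpow 1 * h\<close> in \<open>K\<close>, the second one the part of \<open>u\<close> in \<open>K\<close>.  The
  vector \<open>w\<close> is the projection of \<open>1\<close> onto \<open>K\<close>; it produces the factors in both symbols \<open>alpha\<close>.\<close>

lemma dual_hankel_shift:
  assumes \<phi>: "\<phi> \<in> Linf" and h: "h \<in> M"
  shows "dual_hankel \<theta> \<phi> (T (zpow 1 * h)) - T (zpow (-1) * dual_hankel \<theta> \<phi> h) =
      const_fun (l2_inner h (T (flip (alpha \<theta> (star \<phi>))))) * zpow (-1)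
    - const_fun (l2_inner h (zpow (-1))) * T (flip (alpha \<theta> \<phi>))"
proof -
  let ?H = "dual_hankel \<theta> \<phi>"
  define w where "w = 1 - const_fun (cnj \<theta>0) * \<theta>"
  define c where "c = l2_inner h (zpow (-1))"
  define u where "u = flip (\<phi> * h)"
  have hL: "h \<in> L2" using h by (rule M_closed)
  have uL: "u \<in> L2" unfolding u_def by (intro L2_flip L2_mult_Linf \<phi> hL)
  have wL: "w \<in> L2" unfolding w_def by (intro L2_diff L2_one L2_const M_closed(1)[OF \<theta>_M])
  have zh: "zpow 1 * h \<in> L2" by (rule L2_zpow[OF hL])
  have Tzh: "T (zpow 1 * h) = zpow 1 * h - const_fun c * w"
    using M_shift[OF h] by (simp add: c_def w_def algebra_simps)
  have "?H (T (zpow 1 * h)) = ?H (zpow 1 * h) - ?H (const_fun c * w)"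
    unfolding Tzh by (rule bounded_map_minus[OF dual_hankel_bounded[OF \<phi>] l2_subspace_L2 zh L2_const[OF wL]])
  also have "?H (const_fun c * w) = const_fun c * ?H w"
    using dual_hankel_bounded[OF \<phi>] wL by (simp add: bounded_map_def)
  also have "?H w = T (flip (alpha \<theta> \<phi>))" by (simp add: dual_hankel_def alpha_def w_def)
  also have "?H (zpow 1 * h) = T (zpow (-1) * u)"
    by (simp add: dual_hankel_def u_def flip_simps flip_zpow mult_ac)
  finally have 1: "?H (T (zpow 1 * h)) = T (zpow (-1) * u) - const_fun c * T (flip (alpha \<theta> \<phi>))" .
  have TuL: "T u \<in> L2" using T_M[OF uL] by (rule M_closed)
  have "T (zpow (-1) * u) - T (zpow (-1) * T u) = T (zpow (-1) * (u - T u))"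
    by (subst T_diff[symmetric]) (simp_all add: L2_zpow uL TuL right_diff_distrib)
  also have "\<dots> = const_fun (l2_inner (u - T u) 1) * zpow (-1)" by (rule T_conj_z_K[OF T_K[OF uL]])
  also have "l2_inner (u - T u) 1 = l2_inner h (T (flip (alpha \<theta> (star \<phi>))))"
  proof -
    have "l2_inner (u - T u) 1 = l2_inner u 1 - l2_inner (T u) 1"
      by (simp add: l2_inner_diff_left uL TuL L2_one)
    also have "l2_inner (T u) 1 = l2_inner u (T 1)"
      using T_inner[OF uL T_M[OF L2_one]] T_inner'[OF L2_one T_M[OF uL]] by simp
    also have "l2_inner u 1 - l2_inner u (T 1) = l2_inner u w"
      unfolding w_def T_one
      by (simp add: l2_inner_diff_right uL L2_one L2_const M_closed(1)[OF \<theta>_M])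
    also have "\<dots> = l2_inner h (conj_fun \<phi> * flip w)"
      by (simp add: u_def l2_inner_flip l2_inner_mult)
    also have "conj_fun \<phi> * flip w = flip (alpha \<theta> (star \<phi>))"
      by (simp add: alpha_def star_def flip_simps w_def)
    also have "l2_inner h \<dots> = l2_inner h (T \<dots>)"
    proof (rule T_inner'[symmetric, OF _ h])
      have "conj_fun \<phi> * flip w \<in> L2" by (intro L2_mult_Linf Linf_conj \<phi> L2_flip wL)
      then show "flip (alpha \<theta> (star \<phi>)) \<in> L2" by (simp add: alpha_def star_def flip_simps w_def)
    qed
    finally show ?thesis .
  qed
  finally have 2: "T (zpow (-1) * u) - T (zpow (-1) * T u) =
      const_fun (l2_inner h (T (flip (alpha \<theta> (star \<phi>))))) * zpow (-1)" .
  have "T u = ?H h" by (simp add: u_def dual_hankel_def)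
  with 1 2 show ?thesis by (simp add: c_def algebra_simps)
qed

section \<open>Rigidity of operators intertwining the shift with its adjoint\<close>

text \<open>The backward shift sends \<open>zpow (-n - 1)\<close> to \<open>zpow (-n - 2)\<close> and \<open>\<theta> zpow (n + 1)\<close> to \<open>\<theta> zpow n\<close> for \<open>n \<ge> 0\<close>, and it sends
  \<open>\<theta>\<close> to \<open>\<theta>0 zpow (-1)\<close>.  So it is injective if \<open>\<theta>0 \<noteq> 0\<close>, and otherwise its kernel is spanned by \<open>\<theta>\<close>.\<close>

lemma kernel_backward_shift:
  assumes x: "x \<in> M" and z: "T (zpow (-1) * x) = 0" and h: "\<theta>0 \<noteq> 0 \<or> l2_inner x \<theta> = 0"
  shows "x = 0"
proof -
  have xL: "x \<in> L2" using x by (rule M_closed)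
  define k where "k = zpow (-1) * x"
  have "k \<in> K" using T_K[OF L2_zpow[OF xL, of "-1"]] z by (simp add: k_def)
  then have kH: "k \<in> H2" and k0: "\<And>g. g \<in> H2 \<Longrightarrow> l2_inner k (\<theta> * g) = 0" by (auto simp: K_iff)
  have xk: "x = zpow 1 * k"
    by (simp add: k_def zpow_0 flip: mult.assoc zpow_add)
  have xH: "x \<in> H2" unfolding xk by (intro zpow_mult_H2 kH) simp
  \<comment> \<open>Being in \<open>H2\<close> and in \<open>M\<close>, the vector \<open>x\<close> lies in \<open>\<theta> H2\<close>.\<close>
  define g where "g = proj_H2 (conj_fun \<theta> * x)"
  have gH: "g \<in> H2" unfolding g_def by (intro proj_H2 conj_\<theta>_L2 xL)
  have xg: "x = \<theta> * g"
    using T_id[OF x] by (simp add: Q_theta_def coproj_H2_def proj_H2_id[OF xH] g_def)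
  \<comment> \<open>Orthogonality of \<open>k\<close> to \<open>\<theta> H2\<close> kills all coefficients of \<open>g\<close> but the constant one.\<close>
  have coeff: "fourier_coeff g (n + 1) = 0" if "n \<ge> 0" for n
  proof -
    have "fourier_coeff g (n + 1) = l2_inner (zpow (-1) * g) (zpow n)"
      using fourier_coeff_zpow_mult[of "-1" g n] by (simp add: fourier_coeff_conv_inner)
    also have "\<dots> = l2_inner (conj_fun \<theta> * k) (zpow n)"
      unfolding k_def xg by (subst mult.left_commute) (simp only: conj_\<theta>_mult)
    also have "\<dots> = l2_inner k (\<theta> * zpow n)" by (simp add: l2_inner_mult conj_fun_simps)
    also have "\<dots> = 0" by (intro k0 zpow_H2 that)
    finally show ?thesis .
  qed
  define c where "c = fourier_coeff g 0"
  have gL: "g \<in> L2" by (rule H2_L2[OF gH])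
  have "g - const_fun c * zpow 0 = 0"
  proof (rule fourier_unique)
    show "fourier_coeff (g - const_fun c * zpow 0) n = 0" for n
      using coeff[of "n - 1"] gH
      by (cases n "0 :: int" rule: linorder_cases)
         (auto simp: fourier_coeff_simps gL zpow_L2 L2_const fourier_coeff_zpow c_def H2_def)
  qed (intro L2_diff gL L2_const zpow_L2)
  then have x\<theta>: "x = const_fun c * \<theta>" using xg by (simp add: zpow_0 mult.commute)
  \<comment> \<open>Now \<open>zpow (-1) * x = c \<theta> zpow (-1)\<close> lies in \<open>H2\<close>, although its coefficient at \<open>-1\<close> is \<open>c \<theta>0\<close>.\<close>
  have "fourier_coeff k (-1) = 0" using kH by (simp add: H2_def)
  then have "c * \<theta>0 = 0"
    by (simp add: k_def fourier_coeff_zpow_mult x\<theta> fourier_coeff_simps)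
  moreover have "l2_inner x \<theta> = c"
  proof -
    have "l2_inner \<theta> \<theta> = 1"
      using l2_inner_mult[of \<theta> 1 \<theta>] unimodular_conj[OF unimodular_\<theta>] l2_inner_zpow[of 0 0] by (simp add: zpow_0)
    then show ?thesis by (simp add: x\<theta> l2_inner_const_left)
  qed
  ultimately have "c = 0" using h by auto
  then show ?thesis by (simp add: x\<theta> const_fun_simps)
qed

text \<open>The relation propagates \<open>D \<theta> = 0\<close> along the orbit of the compressed shift: forwards to all
  \<open>\<theta> zpow n\<close> with \<open>n \<ge> 0\<close>, and backwards to all negative powers by injectivity of the backward shift on the
  range of \<open>D\<close>.  These vectors span \<open>M\<close>.\<close>

lemma intertwiner_eq_0:
  assumes D: "bounded_map M M D"
    and comm: "\<And>h. h \<in> M \<Longrightarrow> D (T (zpow 1 * h)) = T (zpow (-1) * D h)"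
    and D\<theta>: "D \<theta> = 0"
    and h: "\<theta>0 \<noteq> 0 \<or> (\<forall>h\<in>M. l2_inner (D h) \<theta> = 0)"
    and f: "f \<in> M"
  shows "D f = 0"
proof -
  have T00: "T 0 = 0" by (rule T_0[OF K_closed(2)])
  have zz: "zpow 1 * zpow (- int n - 2) = zpow (- int n - 1)" for n
  proof -
    have "(1::int) + (- int n - 2) = - int n - 1" by simp
    then show ?thesis by (metis zpow_add)
  qed
  have Dpos: "D (\<theta> * zpow (int n)) = 0" for n
  proof (induction n)
    case 0 then show ?case by (simp add: zpow_0 D\<theta>)
  next
    case (Suc n)
    have "\<theta> * zpow (int n) \<in> M" by (intro \<theta>_H2_M zpow_H2) simp
    then have "D (T (zpow 1 * (\<theta> * zpow (int n)))) = 0" using comm Suc T00 by simp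
    moreover have "zpow 1 * (\<theta> * zpow (int n)) = \<theta> * zpow (int (Suc n))"
      by (simp add: zpow_add mult_ac)
    moreover have "T (\<theta> * zpow (int (Suc n))) = \<theta> * zpow (int (Suc n))"
      by (intro T_id \<theta>_H2_M zpow_H2) simp
    ultimately show ?case by simp
  qed
  have M1: "zpow (- int n - 1) \<in> M" for n by (intro coH2_M zpow_coH2) simp
  have M2: "zpow (- int n - 2) \<in> M" for n by (intro coH2_M zpow_coH2) simp
  have kern: "D x = 0" if "x \<in> M" "T (zpow (-1) * D x) = 0" for x
    by (rule kernel_backward_shift) (use that h D in \<open>auto simp: bounded_map_def\<close>)
  \<comment> \<open>The compressed shift maps \<open>zpow (-1)\<close> to a multiple of \<open>\<theta>\<close>, where the forward orbit begins.\<close>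
  have Dneg: "D (zpow (- int n - 1)) = 0" for n
  proof (induction n)
    case 0
    have "D (T (zpow 1 * zpow (-1))) = D (const_fun (cnj \<theta>0) * \<theta>)"
      by (simp add: zpow_0 T_one flip: zpow_add)
    also have "\<dots> = const_fun (cnj \<theta>0) * D \<theta>" using D \<theta>_M by (simp add: bounded_map_def)
    finally have "T (zpow (-1) * D (zpow (-1))) = 0" using comm[of "zpow (-1)"] M1[of 0] D\<theta> by simp
    then show ?case using kern M1[of 0] by simp
  next
    case (Suc n)
    have e: "- int (Suc n) - 1 = - int n - 2" by simp
    have "T (zpow (-1) * D (zpow (- int n - 2))) = D (T (zpow (- int n - 1)))"
      using comm[OF M2, of n] by (simp only: zz)
    also have "\<dots> = 0" by (simp add: T_id M1 Suc)
    finally show ?case unfolding e by (rule kern[OF M2])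
  qed
  \<comment> \<open>Density is used separately on the two summands of \<open>M\<close>, each an image of all square integrable functions.\<close>
  have b1: "bounded_map L2 M (\<lambda>f. f - proj_H2 f)"
  proof -
    have "bounded_map L2 L2 (\<lambda>f. f)" unfolding bounded_map_def by (auto intro!: exI[of _ 1])
    moreover have "bounded_map L2 L2 proj_H2" using bounded_map_proj_H2 H2_L2 by (auto simp: bounded_map_def)
    ultimately have "bounded_map L2 L2 (\<lambda>f. f - proj_H2 f)" by (rule bounded_map_diff[OF _ _ l2_subspace_L2])
    then show ?thesis using coH2_M proj_H2(2) by (simp add: bounded_map_def)
  qed
  have b2: "bounded_map L2 M (\<lambda>f. \<theta> * proj_H2 f)"
  proof -
    have "bounded_map L2 L2 proj_H2" using bounded_map_proj_H2 H2_L2 by (auto simp: bounded_map_def)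
    then have "bounded_map L2 L2 (\<lambda>f. \<theta> * proj_H2 f)" by (rule bounded_map_compose[OF bounded_map_mult[OF \<theta>_Linf]])
    then show ?thesis using \<theta>_H2_M proj_H2(1) by (simp add: bounded_map_def)
  qed
  have into_L2: "bounded_map L2 L2 R" if "bounded_map L2 M R" for R
    using that M_closed(1) by (simp add: bounded_map_def)
  have fL: "f \<in> L2" using f by (rule M_closed)
  have "D (f - proj_H2 f) = 0"
  proof (rule bounded_map_eq_0[OF into_L2[OF bounded_map_compose[OF D b1]] _ fL])
    fix n :: int
    show "D (zpow n - proj_H2 (zpow n)) = 0"
    proof (cases "n \<ge> 0")
      case True
      then show ?thesis using bounded_map_zero[OF D M_closed(2)] by (simp add: proj_H2_id zpow_H2)
    next
      case False
      then show ?thesis using Dneg[of "nat (- n - 1)"] by (simp add: proj_H2_coH2 zpow_coH2)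
    qed
  qed
  moreover have "D (\<theta> * proj_H2 (conj_fun \<theta> * f)) = 0"
  proof (rule bounded_map_eq_0[OF into_L2[OF bounded_map_compose[OF D b2]] _ conj_\<theta>_L2[OF fL]])
    fix n :: int
    show "D (\<theta> * proj_H2 (zpow n)) = 0"
    proof (cases "n \<ge> 0")
      case True
      then show ?thesis using Dpos[of "nat n"] by (simp add: proj_H2_id zpow_H2)
    next
      case False
      then show ?thesis using bounded_map_zero[OF D M_closed(2)] by (simp add: proj_H2_coH2 zpow_coH2)
    qed
  qed
  moreover have "D f = D (f - proj_H2 f) + D (\<theta> * proj_H2 (conj_fun \<theta> * f))"
  proof -
    have "f - proj_H2 f \<in> M" "\<theta> * proj_H2 (conj_fun \<theta> * f) \<in> M"
      using b1 b2 fL conj_\<theta>_L2[OF fL] by (auto simp: bounded_map_def)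
    then have "D ((f - proj_H2 f) + \<theta> * proj_H2 (conj_fun \<theta> * f)) = D (f - proj_H2 f) + D (\<theta> * proj_H2 (conj_fun \<theta> * f))"
      using D by (simp add: bounded_map_def)
    moreover have "(f - proj_H2 f) + \<theta> * proj_H2 (conj_fun \<theta> * f) = f"
      using T_id[OF f] by (simp add: Q_theta_def coproj_H2_def)
    ultimately show ?thesis by simp
  qed
  ultimately show ?thesis by simp
qed

end

theorem theorem3p10:
  fixes \<theta> \<phi> :: circ_fun and A :: "circ_fun \<Rightarrow> circ_fun"
  assumes "inner_fun \<theta>"
    and "\<phi> \<in> Linf"
    and "bounded_operator_on (model_perp \<theta>) A"
    and "op_eq_on (model_perp \<theta>)
          (\<lambda>h. A (compressed_shift \<theta> h)
             - adjoint_on (model_perp \<theta>) (compressed_shift \<theta>) (A h))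
          (\<lambda>h. rank_one (conj_fun id_fun) (Q_theta \<theta> (flip (alpha \<theta> (star \<phi>)))) h
             - rank_one (Q_theta \<theta> (flip (alpha \<theta> \<phi>))) (conj_fun id_fun) h)"
  shows "(fourier_coeff \<theta> 0 \<noteq> 0 \<longrightarrow>
            (op_eq_on (model_perp \<theta>) A (dual_hankel \<theta> \<phi>) \<longleftrightarrow> A \<theta> = dual_hankel \<theta> \<phi> \<theta>)) \<and>
         (fourier_coeff \<theta> 0 = 0 \<longrightarrow>
            (op_eq_on (model_perp \<theta>) A (dual_hankel \<theta> \<phi>) \<longleftrightarrow>
               A \<theta> = dual_hankel \<theta> \<phi> \<theta> \<and>
               adjoint_on (model_perp \<theta>) A \<theta> =
                 adjoint_on (model_perp \<theta>) (dual_hankel \<theta> \<phi>) \<theta>))"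
proof -
  interpret inner_function \<theta> by unfold_locales fact
  let ?H = "dual_hankel \<theta> \<phi>"
  define D where "D h = A h - ?H h" for h
  have A: "bounded_map M M A" using assms(3) by (simp add: bounded_operator_on_eq)
  have H: "bounded_map M M ?H"
    using dual_hankel_bounded[OF assms(2)] M_closed(1) by (auto simp: bounded_map_def)
  \<comment> \<open>The rank one terms cancel in the difference \<open>D\<close>, which therefore intertwines the shift and its adjoint.\<close>
  have D: "bounded_map M M D"
    unfolding D_def by (rule bounded_map_diff[OF A H l2_subspace_M])
  have comm: "D (T (zpow 1 * h)) = T (zpow (-1) * D h)" if h: "h \<in> M" for h
  proof -
    have Ah: "A h \<in> M" and Hh: "?H h \<in> M" using A H h by (auto simp: bounded_map_def)
    have "A (T (zpow 1 * h)) - T (zpow (-1) * A h) =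
        const_fun (l2_inner h (T (flip (alpha \<theta> (star \<phi>))))) * zpow (-1)
      - const_fun (l2_inner h (zpow (-1))) * T (flip (alpha \<theta> \<phi>))"
      using assms(4)[unfolded op_eq_on_def, rule_format, OF h] adjoint_shift[OF Ah]
      by (simp add: compressed_shift_def rank_one_def conj_zpow flip: zpow_1)
    also have "\<dots> = ?H (T (zpow 1 * h)) - T (zpow (-1) * ?H h)"
      by (rule dual_hankel_shift[OF assms(2) h, symmetric])
    finally have "D (T (zpow 1 * h)) = T (zpow (-1) * A h) - T (zpow (-1) * ?H h)"
      by (simp add: D_def algebra_simps)
    also have "\<dots> = T (zpow (-1) * D h)"
      using Ah Hh by (simp add: D_def right_diff_distrib T_diff L2_zpow M_closed(1))
    finally show ?thesis .
  qed
  have main: "op_eq_on M A ?H"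
    if "A \<theta> = ?H \<theta>" and "\<theta>0 \<noteq> 0 \<or> (\<forall>h\<in>M. l2_inner (D h) \<theta> = 0)"
    unfolding op_eq_on_def
    using intertwiner_eq_0[OF D comm _ that(2)] that(1) by (auto simp: D_def)
  have adj: "\<forall>h\<in>M. l2_inner (D h) \<theta> = 0" if eq: "adjoint_on M A \<theta> = adjoint_on M ?H \<theta>"
  proof
    fix h assume h: "h \<in> M"
    have "l2_inner (A h) \<theta> = l2_inner (?H h) \<theta>"
      using adjoint_on_spec(2)[OF assms(3) \<theta>_M h] adjoint_on_spec(2)[OF _ \<theta>_M h, of ?H] H eq
      by (simp add: bounded_operator_on_eq)
    then show "l2_inner (D h) \<theta> = 0"
      using A H h \<theta>_M by (simp add: D_def l2_inner_diff_left bounded_map_def M_closed(1))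
  qed
  \<comment> \<open>The adjoint depends only on the values on \<open>M\<close>.\<close>
  have adj': "adjoint_on M A \<theta> = adjoint_on M ?H \<theta>" if "op_eq_on M A ?H"
    using that unfolding adjoint_on_def op_eq_on_def by (metis (no_types, lifting))
  show ?thesis using main adj adj' \<theta>_M by (auto simp: op_eq_on_def)
qed

end
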